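(* Let $a>0$ and $p\in\mathbb{R}$ be fixed constants, let $\Pi=(0,1)\times(0,\infty)$ and $\Pi_S=(0,1)\times(0,S)$ for $S>0$. For every $\gamma>0$, and for $M=M(\gamma)$ the constant of the $L^2$-stability estimate recalled in the context, there exist $\varepsilon>0$ and $M_2=M_2(\gamma)\ge M$ such that the following holds. Let $c:\overline{\Pi}\to\mathbb{R}$ be a twice continuously differentiable function such that $c$ and its first and second order partial derivatives are bounded on $\overline{\Pi}$, and suppose $\sup_{S>0}\|c\|_{C^2(\overline{\Pi_S})}<\varepsilon$. Let $w_0\in H^1(0,1)$ and $w_1\in L^2(0,1)$. Then the $L^2$-generalized solution $w$ of the initial-boundary value problem $$w_{tt}-a^2w_{xx}+c(x,t)w=0,\quad (x,t)\in\Pi,$$ $$w(0,t)=p\,(w_t+aw_x)(0,t),\qquad (w_t+aw_x)(1,t)=0,\quad t\in(0,\infty),$$ $$w(x,0)=w_0(x),\qquad w_t(x,0)=w_1(x),\quad x\in[0,1],$$ satisfies, for all integers $\alpha,\beta\ge0$ with $\alpha+\beta\le2$, $$\|\partial_x^{\alpha}\partial_t^{\beta}w(\cdot,t)\|_{C([0,1])}\le M_2e^{-\gamma t}\max\left(\|w_0\|_{H^1(0,1)},\|w_1\|_{L^2(0,1)}\right)\quad\text{for all } t>\frac{6}{a},$$ where $M_2$ and $\gamma$ do not depend on $t$, $w_0$, $w_1$ (the existence of these derivatives being part of the assertion).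
   Context: $H^1(0,1)$ is the space of functions $u\in L^2(0,1)$ with weak derivative $u'\in L^2(0,1)$. $\|c\|_{C^2(\overline{\Pi_S})}$ is the usual $C^2$-norm (supremum over $\overline{\Pi_S}$ of $c$ and its partial derivatives up to order two). As usual, elements of $L^2(0,1)$ are identified with their continuous representatives when these exist. The constant $M(\gamma)$: for every $\gamma>0$ there are $\varepsilon_0>0$ and $M=M(\gamma)$ such that, whenever $\sup_{\Pi}|c|<\varepsilon_0$ (with $c$ in the class described in the claim), the $L^2$-generalized solution of the problem in the claim satisfies $\|w(\cdot,t)\|_{L^2(0,1)}\le Me^{-\gamma t}\max(\|w_0\|_{H^1(0,1)},\|w_1\|_{L^2(0,1)})$ for all $t>0$, $w_0\in H^1(0,1)$, $w_1\in L^2(0,1)$; $M(\gamma)$ denotes such a constant. Definition of the $L^2$-generalized solution. With $u=\partial_t w+a\,\partial_x w$, the wave problem is rewritten as the first order problem $$\partial_t w+a\,\partial_x w-u=0,\qquad \partial_t u-a\,\partial_x u+c(x,t)w=0,\qquad (x,t)\in\Pi,$$ $$w(0,t)=p\,u(0,t),\qquad u(1,t)=0,\qquad t>0,$$ $$w(x,0)=\varphi_1(x),\qquad u(x,0)=\varphi_2(x),\qquad x\in[0,1],$$ where $\varphi_1=w_0$ and $\varphi_2=w_1+a\,\partial_x w_0$ (both in $L^2(0,1)$). For initial data $\varphi_1,\varphi_2$ that are $C^\infty$ with compact support in $(0,1)$, this first order problem has a unique classical ($C^2$) solution. For general $w_0\in H^1(0,1)$, $w_1\in L^2(0,1)$,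 choose sequences $\varphi_1^l,\varphi_2^l\in C_0^\infty(0,1)$ with $\varphi_i^l\to\varphi_i$ in $L^2(0,1)$, $i=1,2$, and let $(w^l,u^l)$ be the classical solution of the first order problem with initial data $(\varphi_1^l,\varphi_2^l)$. There exist unique functions $w,u\in C([0,\infty),L^2(0,1))$ such that $\|w(\cdot,\theta)-w^l(\cdot,\theta)\|_{L^2(0,1)}\to0$ and $\|u(\cdot,\theta)-u^l(\cdot,\theta)\|_{L^2(0,1)}\to0$ as $l\to\infty$, uniformly in $\theta\in[0,t]$, for every $t>0$ (existence and uniqueness are known). The function $w$ is called the $L^2$-generalized solution of the wave problem. *)

theory Defs
  imports "HOL-Analysis.Analysis"
begin

section \<open>Partial derivatives and \<open>C\<^sup>2\<close> functions on a rectangle\<close>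

text \<open>
  A function of \<open>(x, t)\<close> is curried, \<open>f x t\<close>.  The derivatives are taken within the sets
  \<open>X\<close> and \<open>T\<close>, so they are one-sided at endpoints that belong to the rectangle \<open>X \<times> T\<close>, and the
  values of \<open>f\<close> outside \<open>X \<times> T\<close> are irrelevant.
\<close>

definition partial_x :: "real set \<Rightarrow> (real \<Rightarrow> real \<Rightarrow> real) \<Rightarrow> real \<Rightarrow> real \<Rightarrow> real" where
  "partial_x X f = (\<lambda>x t. vector_derivative (\<lambda>y. f y t) (at x within X))"

definition partial_t :: "real set \<Rightarrow> (real \<Rightarrow> real \<Rightarrow> real) \<Rightarrow> real \<Rightarrow> real \<Rightarrow> real" where
  "partial_t T f = (\<lambda>x t. vector_derivative (\<lambda>s. f x s) (at t within T))"

definition partial ::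
    "real set \<Rightarrow> real set \<Rightarrow> nat \<Rightarrow> nat \<Rightarrow> (real \<Rightarrow> real \<Rightarrow> real) \<Rightarrow> real \<Rightarrow> real \<Rightarrow> real" where
  "partial X T \<alpha> \<beta> f = (partial_x X ^^ \<alpha>) ((partial_t T ^^ \<beta>) f)"

text \<open>
  Differentiability has to be required separately, because \<^const>\<open>vector_derivative\<close> is a total
  operator.
\<close>

definition C2_on :: "real set \<Rightarrow> real set \<Rightarrow> (real \<Rightarrow> real \<Rightarrow> real) \<Rightarrow> bool" where
  "C2_on X T f \<longleftrightarrow>
     (\<forall>\<alpha> \<beta>. \<alpha> + \<beta> < 2 \<longrightarrow> (\<forall>x\<in>X. \<forall>t\<in>T.
        (\<lambda>y. partial X T \<alpha> \<beta> f y t) differentiable (at x within X) \<and>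
        (\<lambda>s. partial X T \<alpha> \<beta> f x s) differentiable (at t within T))) \<and>
     (\<forall>\<alpha> \<beta>. \<alpha> + \<beta> \<le> 2 \<longrightarrow>
        continuous_on (X \<times> T) (\<lambda>(x, t). partial X T \<alpha> \<beta> f x t))"

definition C2_bounded_on :: "real set \<Rightarrow> real set \<Rightarrow> (real \<Rightarrow> real \<Rightarrow> real) \<Rightarrow> bool" where
  "C2_bounded_on X T f \<longleftrightarrow> C2_on X T f \<and>
     (\<forall>\<alpha> \<beta>. \<alpha> + \<beta> \<le> 2 \<longrightarrow> bounded ((\<lambda>(x, t). partial X T \<alpha> \<beta> f x t) ` (X \<times> T)))"

definition C2_norm :: "real set \<Rightarrow> real set \<Rightarrow> (real \<Rightarrow> real \<Rightarrow> real) \<Rightarrow> real" where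
  "C2_norm X T f = Sup {\<bar>partial X T \<alpha> \<beta> f x t\<bar> |\<alpha> \<beta> x t. \<alpha> + \<beta> \<le> 2 \<and> x \<in> X \<and> t \<in> T}"

definition sup_norm :: "real set \<Rightarrow> (real \<Rightarrow> real) \<Rightarrow> real" where
  "sup_norm X f = (SUP x\<in>X. \<bar>f x\<bar>)"


section \<open>\<open>L\<^sup>2(0,1)\<close> and \<open>H\<^sup>1(0,1)\<close>\<close>

text \<open>Elements of \<open>L\<^sup>2(0,1)\<close> are represented by functions; only their restriction to \<open>(0,1)\<close>,
  up to null sets, matters.\<close>

abbreviation unit_lebesgue :: "real measure" where
  "unit_lebesgue \<equiv> lebesgue_on {0<..<1}"

definition L2 :: "(real \<Rightarrow> real) \<Rightarrow> bool" where
  "L2 f \<longleftrightarrow> f \<in> borel_measurable unit_lebesgue \<and> integrable unit_lebesgue (\<lambda>x. (f x)\<^sup>2)"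

definition L2_norm :: "(real \<Rightarrow> real) \<Rightarrow> real" where
  "L2_norm f = sqrt (LINT x|unit_lebesgue. (f x)\<^sup>2)"

definition test_function :: "(real \<Rightarrow> real) \<Rightarrow> bool" where
  "test_function \<phi> \<longleftrightarrow>
     (\<forall>n x. (deriv ^^ n) \<phi> differentiable (at x)) \<and>
     (\<exists>K. compact K \<and> K \<subseteq> {0<..<1} \<and> (\<forall>x. x \<notin> K \<longrightarrow> \<phi> x = 0))"

definition has_weak_derivative :: "(real \<Rightarrow> real) \<Rightarrow> (real \<Rightarrow> real) \<Rightarrow> bool" where
  "has_weak_derivative f g \<longleftrightarrow>
     (\<forall>\<phi>. test_function \<phi> \<longrightarrow>
        (LINT x|unit_lebesgue. f x * deriv \<phi> x) = - (LINT x|unit_lebesgue. g x * \<phi> x))"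

definition H1 :: "(real \<Rightarrow> real) \<Rightarrow> bool" where
  "H1 f \<longleftrightarrow> L2 f \<and> (\<exists>g. L2 g \<and> has_weak_derivative f g)"

text \<open>The weak derivative is unique up to null sets; a representative is chosen.\<close>

definition weak_derivative :: "(real \<Rightarrow> real) \<Rightarrow> real \<Rightarrow> real" where
  "weak_derivative f = (SOME g. L2 g \<and> has_weak_derivative f g)"

definition H1_norm :: "(real \<Rightarrow> real) \<Rightarrow> real" where
  "H1_norm f = sqrt ((L2_norm f)\<^sup>2 + (L2_norm (weak_derivative f))\<^sup>2)"

text \<open>\<open>w \<in> C([0,\<infinity>), L\<^sup>2(0,1))\<close>\<close>

definition continuous_into_L2 :: "(real \<Rightarrow> real \<Rightarrow> real) \<Rightarrow> bool" where
  "continuous_into_L2 w \<longleftrightarrow>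
     (\<forall>t\<ge>0. L2 (\<lambda>x. w x t)) \<and>
     (\<forall>s\<ge>0. ((\<lambda>t. L2_norm (\<lambda>x. w x t - w x s)) \<longlongrightarrow> 0) (at s within {0..}))"


section \<open>Solutions of the wave problem\<close>

text \<open>Classical solutions of the first order problem, \<open>C\<^sup>2\<close> up to the boundary.\<close>

definition classical_solution ::
    "real \<Rightarrow> real \<Rightarrow> (real \<Rightarrow> real \<Rightarrow> real) \<Rightarrow> (real \<Rightarrow> real) \<Rightarrow> (real \<Rightarrow> real)
      \<Rightarrow> (real \<Rightarrow> real \<Rightarrow> real) \<Rightarrow> (real \<Rightarrow> real \<Rightarrow> real) \<Rightarrow> bool" where
  "classical_solution a p c \<phi>\<^sub>1 \<phi>\<^sub>2 w u \<longleftrightarrow>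
     C2_on {0..1} {0..} w \<and> C2_on {0..1} {0..} u \<and>
     (\<forall>x\<in>{0<..<1}. \<forall>t>0.
        partial_t {0..} w x t + a * partial_x {0..1} w x t - u x t = 0 \<and>
        partial_t {0..} u x t - a * partial_x {0..1} u x t + c x t * w x t = 0) \<and>
     (\<forall>t>0. w 0 t = p * u 0 t \<and> u 1 t = 0) \<and>
     (\<forall>x\<in>{0..1}. w x 0 = \<phi>\<^sub>1 x \<and> u x 0 = \<phi>\<^sub>2 x)"

text \<open>
  The \<open>L\<^sup>2\<close>-generalized solution \<open>w\<close> of
  \<open>w\<^sub>t\<^sub>t - a\<^sup>2 w\<^sub>x\<^sub>x + c w = 0\<close>, \<open>w(0,t) = p (w\<^sub>t + a w\<^sub>x)(0,t)\<close>, \<open>(w\<^sub>t + a w\<^sub>x)(1,t) = 0\<close>,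
  \<open>w(x,0) = w\<^sub>0\<close>, \<open>w\<^sub>t(x,0) = w\<^sub>1\<close>, obtained through the first order problem for \<open>w\<close> and
  \<open>u = w\<^sub>t + a w\<^sub>x\<close>.  The solution does not depend on the approximating sequence of initial data, so it
  is only required that some sequence approximates it.
\<close>

definition L2_generalized_solution ::
    "real \<Rightarrow> real \<Rightarrow> (real \<Rightarrow> real \<Rightarrow> real) \<Rightarrow> (real \<Rightarrow> real) \<Rightarrow> (real \<Rightarrow> real)
      \<Rightarrow> (real \<Rightarrow> real \<Rightarrow> real) \<Rightarrow> bool" where
  "L2_generalized_solution a p c w\<^sub>0 w\<^sub>1 w \<longleftrightarrow>
     (\<exists>u \<phi>\<^sub>1 \<phi>\<^sub>2 wl ul.
        continuous_into_L2 w \<and> continuous_into_L2 u \<and>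
        (\<forall>l::nat. test_function (\<phi>\<^sub>1 l) \<and> test_function (\<phi>\<^sub>2 l) \<and>
           classical_solution a p c (\<phi>\<^sub>1 l) (\<phi>\<^sub>2 l) (wl l) (ul l)) \<and>
        (\<lambda>l. L2_norm (\<lambda>x. \<phi>\<^sub>1 l x - w\<^sub>0 x)) \<longlonglongrightarrow> 0 \<and>
        (\<lambda>l. L2_norm (\<lambda>x. \<phi>\<^sub>2 l x - (w\<^sub>1 x + a * weak_derivative w\<^sub>0 x))) \<longlonglongrightarrow> 0 \<and>
        (\<forall>t>0. uniform_limit {0..t} (\<lambda>l \<theta>. L2_norm (\<lambda>x. w x \<theta> - wl l x \<theta>)) (\<lambda>\<theta>. 0) sequentially \<and>
               uniform_limit {0..t} (\<lambda>l \<theta>. L2_norm (\<lambda>x. u x \<theta> - ul l x \<theta>)) (\<lambda>\<theta>. 0) sequentially))"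


section \<open>The constant of the \<open>L\<^sup>2\<close>-stability estimate\<close>

definition L2_stability_estimate :: "real \<Rightarrow> real \<Rightarrow> real \<Rightarrow> real \<Rightarrow> bool" where
  "L2_stability_estimate a p \<gamma> M \<longleftrightarrow>
     (\<exists>\<epsilon>\<^sub>0>0. \<forall>c. C2_bounded_on {0..1} {0..} c \<longrightarrow>
        (SUP (x, t)\<in>{0<..<1} \<times> {0<..}. \<bar>c x t\<bar>) < \<epsilon>\<^sub>0 \<longrightarrow>
        (\<forall>w\<^sub>0 w\<^sub>1 w. H1 w\<^sub>0 \<longrightarrow> L2 w\<^sub>1 \<longrightarrow> L2_generalized_solution a p c w\<^sub>0 w\<^sub>1 w \<longrightarrow>
           (\<forall>t>0. L2_norm (\<lambda>x. w x t)
                   \<le> M * exp (- \<gamma> * t) * max (H1_norm w\<^sub>0) (L2_norm w\<^sub>1))))"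

text \<open>
  \<open>M(\<gamma>)\<close>: a fixed choice of a constant for which the \<open>L\<^sup>2\<close>-stability estimate holds.
\<close>

definition stability_constant :: "real \<Rightarrow> real \<Rightarrow> real \<Rightarrow> real" where
  "stability_constant a p \<gamma> = (SOME M. L2_stability_estimate a p \<gamma> M)"

end

theory Submission
  imports Defs
begin

text \<open>
  Put \<open>h = 1/a\<close>.  The first order problem reads \<open>w\<^sub>x + h w\<^sub>t = h u\<close>, \<open>u\<^sub>x - h u\<^sub>t = h c w\<close>, so \<open>w\<close> travels to the
  right and \<open>u\<close> to the left, and each needs the time \<open>h\<close> to cross the interval.  Since \<open>u\<close> enters
  with the value \<open>0\<close> at \<open>x = 1\<close>, nothing remains of the initial \<open>u\<close> after the time \<open>h\<close>, and from then on
  \<open>u(x,t) = - h \<integral> c w\<close> along the leftward characteristic through \<open>(x,t)\<close> (\<open>u_integral\<close>).  Likewise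
  \<open>w(x,t) = p u(0,t-hx) + h \<integral> u\<close> along the rightward characteristic (\<open>w_integral\<close>).

  Decay.  If \<open>\<bar>c\<bar> \<le> \<epsilon>\<close>, then by these two formulas the solution is of size \<open>O(\<epsilon>)\<close>, relative to the norm of
  the initial data, at times between \<open>2h\<close> and \<open>12h\<close>.  Iterating this over windows of length \<open>6h\<close> gives decay
  at any prescribed rate \<open>\<gamma>\<close>, provided that \<open>\<epsilon>\<close> is small (\<open>exponential_decay\<close>).

  Regularity.  In the formula for \<open>u\<close> one integrates along the leftward characteristics, which are
  transversal to the rightward ones, along which \<open>w\<close> is as regular as \<open>u\<close>.  Hence the integral gains a
  derivative: \<open>w\<^sub>t\<close> is a combination of \<open>u\<close> and of the derivative of \<open>w\<close> along the leftward
  characteristic, and an integration by parts removes the latter (\<open>u_time_integral\<close>).  So \<open>u\<^sub>t\<close> is controlled by \<open>w\<close>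
  and \<open>u\<close> during the preceding time \<open>h\<close>, and the formula for \<open>w\<close> passes the bound on to \<open>w\<^sub>t\<close>, again with
  the delay \<open>h\<close>.  Bounds hold successively for \<open>u\<close> from the time \<open>h\<close> on, for \<open>w\<close> from \<open>2h\<close>, \<open>u\<^sub>t\<close> from \<open>3h\<close>,
  \<open>w\<^sub>t\<close> from \<open>4h\<close>, \<open>u\<^sub>t\<^sub>t\<close> from \<open>5h\<close> and \<open>w\<^sub>t\<^sub>t\<close> from \<open>6h\<close>; this is the threshold \<open>6/a\<close>.  The
  other derivatives of \<open>w\<close> follow from the equations (\<open>window_bounds\<close>).

  The chain starts from data in \<open>L\<^sup>2\<close>, which requires a bound for the integral of \<open>w\<^sup>2\<close> over a leftward
  characteristic by the initial energy.  It comes from the energy on the segments that interpolate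
  between the initial line and the characteristic (\<open>characteristic_energy\<close>).

  All this concerns classical solutions.  The problem is linear and the bounds only see the \<open>L\<^sup>2\<close> norms
  of the data, so they apply to differences of the approximating classical solutions.  These therefore form a
  Cauchy sequence in the \<open>C\<^sup>2\<close> norm on \<open>t > 6/a\<close>; the limit coincides with the generalized solution
  almost everywhere, and it inherits the bounds.
\<close>

section \<open>Families of partial derivatives up to order two\<close>

text \<open>
  \<open>D \<alpha> \<beta>\<close> plays the role of the derivative of \<open>D 0 0\<close> of order \<open>\<alpha>\<close> in \<open>x\<close> and \<open>\<beta>\<close> in \<open>t\<close>.  Such
  families are stable under subtraction, restriction and uniform limits by the usual rules for derivatives,
  and the symmetry of the mixed derivatives is built in.
\<close>

definition C2_family ::
    "real set \<Rightarrow> real set \<Rightarrow> (nat \<Rightarrow> nat \<Rightarrow> real \<Rightarrow> real \<Rightarrow> real) \<Rightarrow> bool" where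
  "C2_family X T D \<longleftrightarrow>
     (\<forall>\<alpha> \<beta>. \<alpha> + \<beta> < 2 \<longrightarrow> (\<forall>x\<in>X. \<forall>t\<in>T.
        ((\<lambda>y. D \<alpha> \<beta> y t) has_real_derivative D (Suc \<alpha>) \<beta> x t) (at x within X) \<and>
        ((\<lambda>s. D \<alpha> \<beta> x s) has_real_derivative D \<alpha> (Suc \<beta>) x t) (at t within T))) \<and>
     (\<forall>\<alpha> \<beta>. \<alpha> + \<beta> \<le> 2 \<longrightarrow> continuous_on (X \<times> T) (\<lambda>(x, t). D \<alpha> \<beta> x t))"

lemma C2_family_x:
  "\<lbrakk>C2_family X T D; \<alpha> + \<beta> < 2; x \<in> X; t \<in> T\<rbrakk> \<Longrightarrow>
    ((\<lambda>y. D \<alpha> \<beta> y t) has_real_derivative D (Suc \<alpha>) \<beta> x t) (at x within X)"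
  unfolding C2_family_def by blast

lemma C2_family_t:
  "\<lbrakk>C2_family X T D; \<alpha> + \<beta> < 2; x \<in> X; t \<in> T\<rbrakk> \<Longrightarrow>
    ((\<lambda>s. D \<alpha> \<beta> x s) has_real_derivative D \<alpha> (Suc \<beta>) x t) (at t within T)"
  unfolding C2_family_def by blast

lemma C2_family_continuous:
  "\<lbrakk>C2_family X T D; \<alpha> + \<beta> \<le> 2\<rbrakk> \<Longrightarrow> continuous_on (X \<times> T) (\<lambda>(x, t). D \<alpha> \<beta> x t)"
  unfolding C2_family_def by blast

lemma C2_family_diff:
  assumes "C2_family X T D" "C2_family X T E"
  shows "C2_family X T (\<lambda>\<alpha> \<beta> x t. D \<alpha> \<beta> x t - E \<alpha> \<beta> x t)"
  using assms unfolding C2_family_def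
  by (auto intro!: DERIV_diff continuous_on_diff simp: case_prod_beta)

lemma C2_family_subset:
  assumes "C2_family X T D" "T' \<subseteq> T"
  shows "C2_family X T' D"
  unfolding C2_family_def
proof (intro conjI allI impI ballI)
  fix \<alpha> \<beta> :: nat and x t assume *: "\<alpha> + \<beta> < 2" "x \<in> X" "t \<in> T'"
  show "((\<lambda>y. D \<alpha> \<beta> y t) has_real_derivative D (Suc \<alpha>) \<beta> x t) (at x within X)"
    using * assms by (auto intro: C2_family_x)
  show "((\<lambda>s. D \<alpha> \<beta> x s) has_real_derivative D \<alpha> (Suc \<beta>) x t) (at t within T')"
    using * assms by (auto intro: has_field_derivative_subset[OF C2_family_t])
next
  fix \<alpha> \<beta> :: nat assume "\<alpha> + \<beta> \<le> 2"
  then show "continuous_on (X \<times> T') (\<lambda>(x, t). D \<alpha> \<beta> x t)"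
    using C2_family_continuous[OF assms(1)] assms(2) by (auto intro: continuous_on_subset)
qed

lemma has_real_derivative_transform:
  fixes f g :: "real \<Rightarrow> real"
  assumes "x \<in> S" "\<And>y. y \<in> S \<Longrightarrow> f y = g y" "(g has_real_derivative d) (at x within S)"
  shows "(f has_real_derivative d) (at x within S)"
  using assms has_derivative_transform unfolding has_field_derivative_def by blast

lemma vector_derivative_within_eq:
  fixes f g :: "real \<Rightarrow> real"
  assumes "(g has_real_derivative d) (at x within S)" "x \<in> S" "at x within S \<noteq> bot"
    and "\<And>y. y \<in> S \<Longrightarrow> f y = g y"
  shows "vector_derivative f (at x within S) = d"
proof -
  have "(f has_real_derivative d) (at x within S)"
    using has_real_derivative_transform[OF assms(2,4,1)] .
  then show ?thesis
    using assms(3) by (auto intro: vector_derivative_within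
        simp: has_real_derivative_iff_has_vector_derivative)
qed

text \<open>
  The derivatives \<open>at x within X\<close> are unique at limit points only, whence the last assumptions on
  \<open>X\<close> and \<open>T\<close>.
\<close>

lemma partial_eq_C2_family:
  assumes D: "C2_family X T D" and f: "\<And>x t. x \<in> X \<Longrightarrow> t \<in> T \<Longrightarrow> f x t = D 0 0 x t"
    and X: "\<And>x. x \<in> X \<Longrightarrow> at x within X \<noteq> bot" and T: "\<And>t. t \<in> T \<Longrightarrow> at t within T \<noteq> bot"
    and "\<alpha> + \<beta> \<le> 2" "x \<in> X" "t \<in> T"
  shows "partial X T \<alpha> \<beta> f x t = D \<alpha> \<beta> x t"
proof -
  have time: "partial X T 0 \<beta> f x t = D 0 \<beta> x t" if "\<beta> \<le> 2" "x \<in> X" "t \<in> T" for \<beta> x t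
    using that
  proof (induction \<beta> arbitrary: x t)
    case 0 then show ?case using f by (simp add: partial_def)
  next
    case (Suc \<beta>)
    have "vector_derivative (\<lambda>s. partial X T 0 \<beta> f x s) (at t within T) = D 0 (Suc \<beta>) x t"
      by (rule vector_derivative_within_eq[OF C2_family_t[OF D] _ T])
         (use Suc in auto)
    then show ?case by (simp add: partial_def partial_t_def)
  qed
  show ?thesis using assms(5-)
  proof (induction \<alpha> arbitrary: x t)
    case 0 then show ?case using time by simp
  next
    case (Suc \<alpha>)
    have "vector_derivative (\<lambda>y. partial X T \<alpha> \<beta> f y t) (at x within X) = D (Suc \<alpha>) \<beta> x t"
      by (rule vector_derivative_within_eq[OF C2_family_x[OF D] _ X])
         (use Suc in auto)
    then show ?case by (simp add: partial_def partial_x_def)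
  qed
qed

lemma C2_on_C2_family:
  assumes D: "C2_family X T D" and f: "\<And>x t. x \<in> X \<Longrightarrow> t \<in> T \<Longrightarrow> f x t = D 0 0 x t"
    and X: "\<And>x. x \<in> X \<Longrightarrow> at x within X \<noteq> bot" and T: "\<And>t. t \<in> T \<Longrightarrow> at t within T \<noteq> bot"
  shows "C2_on X T f"
  unfolding C2_on_def
proof (intro conjI allI impI ballI)
  note eq = partial_eq_C2_family[OF D f X T]
  fix \<alpha> \<beta> :: nat and x t assume *: "\<alpha> + \<beta> < 2" "x \<in> X" "t \<in> T"
  have "((\<lambda>y. partial X T \<alpha> \<beta> f y t) has_real_derivative D (Suc \<alpha>) \<beta> x t) (at x within X)"
    by (rule has_real_derivative_transform[OF _ _ C2_family_x[OF D]])
       (use * eq[of \<alpha> \<beta>] in auto)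
  then show "(\<lambda>y. partial X T \<alpha> \<beta> f y t) differentiable (at x within X)"
    unfolding has_field_derivative_def differentiable_def by blast
  have "((\<lambda>s. partial X T \<alpha> \<beta> f x s) has_real_derivative D \<alpha> (Suc \<beta>) x t) (at t within T)"
    by (rule has_real_derivative_transform[OF _ _ C2_family_t[OF D]])
       (use * eq[of \<alpha> \<beta>] in auto)
  then show "(\<lambda>s. partial X T \<alpha> \<beta> f x s) differentiable (at t within T)"
    unfolding has_field_derivative_def differentiable_def by blast
next
  fix \<alpha> \<beta> :: nat assume *: "\<alpha> + \<beta> \<le> 2"
  show "continuous_on (X \<times> T) (\<lambda>(x, t). partial X T \<alpha> \<beta> f x t)"
    using C2_family_continuous[OF D *]
    by (rule continuous_on_eq) (use partial_eq_C2_family[OF D f X T *] in auto)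
qed

lemma C2_family_uniform_limit:
  assumes D: "\<And>n. C2_family X T (D n)" and "convex X" "convex T"
    and lim: "\<And>\<alpha> \<beta>. \<alpha> + \<beta> \<le> 2 \<Longrightarrow>
        uniform_limit (X \<times> T) (\<lambda>n (x, t). D n \<alpha> \<beta> x t) (\<lambda>(x, t). E \<alpha> \<beta> x t) sequentially"
  shows "C2_family X T E"
proof -
  have *: "(f has_real_derivative f' x) (at x within S)"
    if "convex S" "x \<in> S" and F: "\<And>n x. x \<in> S \<Longrightarrow> (F n has_real_derivative F' n x) (at x within S)"
      and f: "\<And>x. x \<in> S \<Longrightarrow> (\<lambda>n. F n x) \<longlonglongrightarrow> f x"
      and f': "uniform_limit S F' f' sequentially" for F F' :: "nat \<Rightarrow> real \<Rightarrow> real" and f f' :: "real \<Rightarrow> real" and S x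
  proof -
    have "\<exists>g. \<forall>x\<in>S. (\<lambda>n. F n x) \<longlonglongrightarrow> g x \<and> (g has_derivative (*) (f' x)) (at x within S)"
    proof (rule has_derivative_sequence[where f = F and f' = "\<lambda>n x. (*) (F' n x)"])
      show "convex S" "x \<in> S" "(\<lambda>n. F n x) \<longlonglongrightarrow> f x" using that(1,2) f by auto
      show "(F n has_derivative (*) (F' n x)) (at x within S)" if "x \<in> S" for n x
        using F[OF that] by (simp add: has_field_derivative_def)
      fix e :: real assume "e > 0"
      with f' have "\<forall>\<^sub>F n in sequentially. \<forall>x\<in>S. dist (F' n x) (f' x) < e"
        by (simp add: uniform_limit_iff)
      then show "\<forall>\<^sub>F n in sequentially. \<forall>x\<in>S. \<forall>h. norm (F' n x * h - f' x * h) \<le> e * norm h"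
        by eventually_elim
           (auto simp: dist_real_def abs_mult left_diff_distrib[symmetric] intro!: mult_right_mono
             dest!: bspec)
    qed
    then obtain g where g: "\<And>x. x \<in> S \<Longrightarrow> (\<lambda>n. F n x) \<longlonglongrightarrow> g x"
        "\<And>x. x \<in> S \<Longrightarrow> (g has_derivative (*) (f' x)) (at x within S)" by blast
    have "g y = f y" if "y \<in> S" for y using LIMSEQ_unique[OF g(1)[OF that] f[OF that]] .
    then show ?thesis
      using has_real_derivative_transform[OF \<open>x \<in> S\<close>, of f g] g(2)[OF \<open>x \<in> S\<close>]
      by (simp add: has_field_derivative_def)
  qed
  have pt: "(\<lambda>n. D n \<alpha> \<beta> x t) \<longlonglongrightarrow> E \<alpha> \<beta> x t" if "\<alpha> + \<beta> \<le> 2" "x \<in> X" "t \<in> T" for \<alpha> \<beta> x t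
    using tendsto_uniform_limitI[OF lim[OF that(1)], of "(x, t)"] that by simp
  have ulx: "uniform_limit X (\<lambda>n x. D n \<alpha> \<beta> x t) (\<lambda>x. E \<alpha> \<beta> x t) sequentially"
    if "\<alpha> + \<beta> \<le> 2" "t \<in> T" for \<alpha> \<beta> t
    using uniform_limit_compose'[OF lim[OF that(1)], of "\<lambda>x. (x, t)" X] that by auto
  have ult: "uniform_limit T (\<lambda>n t. D n \<alpha> \<beta> x t) (\<lambda>t. E \<alpha> \<beta> x t) sequentially"
    if "\<alpha> + \<beta> \<le> 2" "x \<in> X" for \<alpha> \<beta> x
    using uniform_limit_compose'[OF lim[OF that(1)], of "\<lambda>t. (x, t)" T] that by auto
  show ?thesis unfolding C2_family_def
  proof (intro conjI allI impI ballI)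
    fix \<alpha> \<beta> :: nat and x t assume a: "\<alpha> + \<beta> < 2" "x \<in> X" "t \<in> T"
    show "((\<lambda>y. E \<alpha> \<beta> y t) has_real_derivative E (Suc \<alpha>) \<beta> x t) (at x within X)"
    proof (rule *[where F = "\<lambda>n y. D n \<alpha> \<beta> y t" and F' = "\<lambda>n y. D n (Suc \<alpha>) \<beta> y t"
            and f' = "\<lambda>y. E (Suc \<alpha>) \<beta> y t", OF \<open>convex X\<close> a(2)])
      show "((\<lambda>y. D n \<alpha> \<beta> y t) has_real_derivative D n (Suc \<alpha>) \<beta> y t) (at y within X)"
        if "y \<in> X" for n y using C2_family_x[OF D a(1) that a(3)] .
      show "(\<lambda>n. D n \<alpha> \<beta> y t) \<longlonglongrightarrow> E \<alpha> \<beta> y t" if "y \<in> X" for y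
        by (rule pt) (use a that in auto)
      show "uniform_limit X (\<lambda>n y. D n (Suc \<alpha>) \<beta> y t) (\<lambda>y. E (Suc \<alpha>) \<beta> y t) sequentially"
        by (rule ulx) (use a in auto)
    qed
    show "((\<lambda>s. E \<alpha> \<beta> x s) has_real_derivative E \<alpha> (Suc \<beta>) x t) (at t within T)"
    proof (rule *[where F = "\<lambda>n s. D n \<alpha> \<beta> x s" and F' = "\<lambda>n s. D n \<alpha> (Suc \<beta>) x s"
            and f' = "\<lambda>s. E \<alpha> (Suc \<beta>) x s", OF \<open>convex T\<close> a(3)])
      show "((\<lambda>s. D n \<alpha> \<beta> x s) has_real_derivative D n \<alpha> (Suc \<beta>) x s) (at s within T)"
        if "s \<in> T" for n s using C2_family_t[OF D a(1,2) that] .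
      show "(\<lambda>n. D n \<alpha> \<beta> x s) \<longlonglongrightarrow> E \<alpha> \<beta> x s" if "s \<in> T" for s
        by (rule pt) (use a that in auto)
      show "uniform_limit T (\<lambda>n s. D n \<alpha> (Suc \<beta>) x s) (\<lambda>s. E \<alpha> (Suc \<beta>) x s) sequentially"
        by (rule ult) (use a in auto)
    qed
  next
    fix \<alpha> \<beta> :: nat assume "\<alpha> + \<beta> \<le> 2"
    then show "continuous_on (X \<times> T) (\<lambda>(x, t). E \<alpha> \<beta> x t)"
      using C2_family_continuous[OF D] by (intro uniform_limit_theorem[OF _ lim]) auto
  qed
qed

lemma continuous_on_slice:
  assumes "continuous_on (X \<times> T) (\<lambda>(x, t). f x t)"
  shows "x \<in> X \<Longrightarrow> continuous_on T (\<lambda>t. f x t)" "t \<in> T \<Longrightarrow> continuous_on X (\<lambda>x. f x t)"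
proof -
  show "continuous_on T (\<lambda>t. f x t)" if "x \<in> X"
    using continuous_on_compose2[OF assms continuous_on_Pair[OF continuous_on_const[of T x] continuous_on_id]] that
    by auto
  show "continuous_on X (\<lambda>x. f x t)" if "t \<in> T"
    using continuous_on_compose2[OF assms continuous_on_Pair[OF continuous_on_id continuous_on_const[of X t]]] that
    by auto
qed

lemma at_within_halfline_eq: "at t within {0..} = at t within {0..t + 1}" for t :: real
  by (rule at_within_nhd[of _ "{..<t+1}"]) auto

text \<open>
  Differentiating \<open>f(x,t) = f(x,0) + \<integral>\<^sub>0\<^sup>t f\<^sub>t(x,s) ds\<close> in \<open>x\<close> gives \<open>f\<^sub>x(x,t) = f\<^sub>x(x,0) + \<integral>\<^sub>0\<^sup>t f\<^sub>t\<^sub>x(x,s) ds\<close>, and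
  the fundamental theorem of calculus yields \<open>\<partial>\<^sub>t f\<^sub>x = f\<^sub>t\<^sub>x\<close>.
\<close>

lemma mixed_partials_commute:
  fixes f fx ft ftx :: "real \<Rightarrow> real \<Rightarrow> real"
  assumes fx: "\<And>x t. x \<in> {0..1} \<Longrightarrow> t \<ge> 0 \<Longrightarrow>
      ((\<lambda>y. f y t) has_real_derivative fx x t) (at x within {0..1})"
    and ft: "\<And>x t. x \<in> {0..1} \<Longrightarrow> t \<ge> 0 \<Longrightarrow>
      ((\<lambda>s. f x s) has_real_derivative ft x t) (at t within {0..})"
    and ftx: "\<And>x t. x \<in> {0..1} \<Longrightarrow> t \<ge> 0 \<Longrightarrow>
      ((\<lambda>y. ft y t) has_real_derivative ftx x t) (at x within {0..1})"
    and cft: "continuous_on ({0..1} \<times> {0..}) (\<lambda>(x, t). ft x t)"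
    and cftx: "continuous_on ({0..1} \<times> {0..}) (\<lambda>(x, t). ftx x t)"
    and x: "x \<in> {0..1}" and t: "t \<ge> 0"
  shows "((\<lambda>s. fx x s) has_real_derivative ftx x t) (at t within {0..})"
proof -
  have ftint: "integral {0..s} (ft y) = f y s - f y 0" if "y \<in> {0..1}" "s \<ge> 0" for y s
  proof -
    have "(ft y has_integral f y s - f y 0) {0..s}"
      using that by (intro fundamental_theorem_of_calculus)
        (auto simp flip: has_real_derivative_iff_has_vector_derivative
          intro: has_field_derivative_subset[OF ft])
    then show ?thesis by blast
  qed
  have eq: "fx x s = fx x 0 + integral {0..s} (ftx x)" if s: "s \<ge> 0" for s
  proof -
    have "((\<lambda>y. integral (cbox 0 s) (ft y)) has_real_derivative integral (cbox 0 s) (ftx x))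
        (at x within {0..1})"
    proof (rule leibniz_rule_field_derivative)
      show "((\<lambda>y. ft y r) has_real_derivative ftx y r) (at y within {0..1})"
        if "y \<in> {0..1}" "r \<in> cbox 0 s" for y r using ftx that by simp
      show "ft y integrable_on cbox 0 s" if "y \<in> {0..1}" for y
        using continuous_on_subset[OF continuous_on_slice(1)[OF cft that], of "{0..s}"]
        by (auto intro: integrable_continuous_real)
      show "continuous_on ({0..1} \<times> cbox 0 s) (\<lambda>(y, r). ftx y r)"
        by (rule continuous_on_subset[OF cftx]) auto
    qed (use x in auto)
    then have 1: "((\<lambda>y. f y s - f y 0) has_real_derivative integral {0..s} (ftx x)) (at x within {0..1})"
      unfolding cbox_interval
      by (rule has_real_derivative_transform[rotated 2]) (use ftint s x in auto)
    have 2: "((\<lambda>y. f y s - f y 0) has_real_derivative fx x s - fx x 0) (at x within {0..1})"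
      using fx x s by (intro DERIV_diff) auto
    have "at x within {0..1} \<noteq> bot"
      using x by (simp add: trivial_limit_within islimpt_Icc)
    from has_field_derivative_unique[OF 1 2 this] show ?thesis by simp
  qed
  have "continuous_on {0..t+1} (ftx x)"
    using continuous_on_slice(1)[OF cftx x] by (rule continuous_on_subset) auto
  then have "((\<lambda>s. integral {0..s} (ftx x)) has_real_derivative ftx x t) (at t within {0..t+1})"
    by (rule integral_has_real_derivative) (use t in auto)
  then have "((\<lambda>s. fx x 0 + integral {0..s} (ftx x)) has_real_derivative ftx x t) (at t within {0..})"
    unfolding at_within_halfline_eq by (auto intro!: derivative_eq_intros)
  then show ?thesis
    by (rule has_real_derivative_transform[rotated 2]) (use t in \<open>auto intro: eq\<close>)
qed

lemma at_within_nonbot: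
  fixes x :: real
  shows "x \<in> {0..1} \<Longrightarrow> at x within {0..1} \<noteq> bot" "x \<in> {0..} \<Longrightarrow> at x within {0..} \<noteq> bot"
    "s > 0 \<Longrightarrow> x \<in> {0..s} \<Longrightarrow> at x within {0..s} \<noteq> bot" "x \<in> {s<..} \<Longrightarrow> at x within {s<..} \<noteq> bot"
proof -
  show *: "s > 0 \<Longrightarrow> x \<in> {0..s} \<Longrightarrow> at x within {0..s} \<noteq> bot" for s
    by (simp add: trivial_limit_within islimpt_Icc)
  show "x \<in> {0..1} \<Longrightarrow> at x within {0..1} \<noteq> bot" using *[of 1] by simp
  show "x \<in> {0..} \<Longrightarrow> at x within {0..} \<noteq> bot"
    unfolding at_within_halfline_eq using *[of "x+1"] by simp
  show "x \<in> {s<..} \<Longrightarrow> at x within {s<..} \<noteq> bot" by (simp add: at_within_open[of _ "{s<..}"])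
qed

text \<open>
  The only case that is not part of the definition of \<^const>\<open>C2_on\<close> is \<open>\<partial>\<^sub>t (\<partial>\<^sub>x f) = \<partial>\<^sub>x (\<partial>\<^sub>t f)\<close>.
\<close>

lemma C2_family_partial:
  assumes f: "C2_on {0..1} {0..} f"
  shows "C2_family {0..1} {0..} (\<lambda>\<alpha> \<beta>. partial {0..1} {0..} \<alpha> \<beta> f)"
proof -
  let ?P = "\<lambda>\<alpha> \<beta>. partial {0..1} {0..} \<alpha> \<beta> f"
  have dx: "((\<lambda>y. ?P \<alpha> \<beta> y t) has_real_derivative ?P (Suc \<alpha>) \<beta> x t) (at x within {0..1})"
    if "\<alpha> + \<beta> < 2" "x \<in> {0..1}" "t \<in> {0..}" for \<alpha> \<beta> x t
  proof -
    have "(\<lambda>y. ?P \<alpha> \<beta> y t) differentiable (at x within {0..1})"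
      using f that unfolding C2_on_def by blast
    then show ?thesis
      by (simp add: partial_def partial_x_def vector_derivative_works
        has_real_derivative_iff_has_vector_derivative)
  qed
  have dt: "((\<lambda>s. ?P 0 \<beta> x s) has_real_derivative ?P 0 (Suc \<beta>) x t) (at t within {0..})"
    if "\<beta> < 2" "x \<in> {0..1}" "t \<in> {0..}" for \<beta> x t
  proof -
    have "(\<lambda>s. ?P 0 \<beta> x s) differentiable (at t within {0..})"
      using f that unfolding C2_on_def by (metis add_0)
    then show ?thesis
      by (simp add: partial_def partial_t_def vector_derivative_works
        has_real_derivative_iff_has_vector_derivative)
  qed
  have c: "continuous_on ({0..1} \<times> {0..}) (\<lambda>(x, t). ?P \<alpha> \<beta> x t)" if "\<alpha> + \<beta> \<le> 2" for \<alpha> \<beta>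
    using that f unfolding C2_on_def by blast
  have dxt: "((\<lambda>s. ?P 1 0 x s) has_real_derivative ?P 1 1 x t) (at t within {0..})"
    if "x \<in> {0..1}" "t \<in> {0..}" for x t
    by (rule mixed_partials_commute[where f = "?P 0 0" and ft = "?P 0 1"])
       (use that dx[of 0] dt[of 0] c[of 0 1] c[of 1 1] in auto)
  show ?thesis unfolding C2_family_def
  proof (intro conjI allI impI ballI)
    fix \<alpha> \<beta> :: nat and x t :: real assume *: "\<alpha> + \<beta> < 2" "x \<in> {0..1}" "t \<in> {0..}"
    show "((\<lambda>y. ?P \<alpha> \<beta> y t) has_real_derivative ?P (Suc \<alpha>) \<beta> x t) (at x within {0..1})"
      using dx * .
    have "\<alpha> = 0 \<or> \<alpha> = 1 \<and> \<beta> = 0" using * by linarith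
    then show "((\<lambda>s. ?P \<alpha> \<beta> x s) has_real_derivative ?P \<alpha> (Suc \<beta>) x t) (at t within {0..})"
      using dt dxt * by auto
  qed (use c in auto)
qed

lemma C2_family_Cauchy:
  assumes D: "\<And>l. C2_family X T (D l)" and "convex X" "convex T"
    and Cauchy: "\<And>\<alpha> \<beta>. \<alpha> + \<beta> \<le> 2 \<Longrightarrow>
        uniformly_Cauchy_on (X \<times> T) (\<lambda>l (x, t). D l \<alpha> \<beta> x t)"
  obtains L where "C2_family X T L"
    and "\<And>\<alpha> \<beta>. \<alpha> + \<beta> \<le> 2 \<Longrightarrow>
        uniform_limit (X \<times> T) (\<lambda>l (x, t). D l \<alpha> \<beta> x t) (\<lambda>(x, t). L \<alpha> \<beta> x t) sequentially"
proof -
  define L where "L \<alpha> \<beta> x t = lim (\<lambda>l. D l \<alpha> \<beta> x t)" for \<alpha> \<beta> x t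
  have lim: "uniform_limit (X \<times> T) (\<lambda>l (x, t). D l \<alpha> \<beta> x t) (\<lambda>(x, t). L \<alpha> \<beta> x t) sequentially"
    if "\<alpha> + \<beta> \<le> 2" for \<alpha> \<beta>
  proof -
    have "uniformly_convergent_on (X \<times> T) (\<lambda>l (x, t). D l \<alpha> \<beta> x t)"
      using Cauchy[OF that] by (simp add: uniformly_convergent_eq_Cauchy)
    then have "uniform_limit (X \<times> T) (\<lambda>l (x, t). D l \<alpha> \<beta> x t)
        (\<lambda>z. lim (\<lambda>l. case z of (x, t) \<Rightarrow> D l \<alpha> \<beta> x t)) sequentially"
      by (simp add: uniformly_convergent_uniform_limit_iff)
    then show ?thesis by (simp add: L_def case_prod_beta')
  qed
  show ?thesis using that[OF C2_family_uniform_limit[OF D assms(2,3) lim] lim] .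
qed

section \<open>Integrals over characteristics\<close>

lemma continuous_on_curve:
  assumes "continuous_on (X \<times> T) (\<lambda>(x, t). f x t)"
    and "continuous_on S g" "continuous_on S k" "\<And>s. s \<in> S \<Longrightarrow> g s \<in> X \<and> k s \<in> T"
  shows "continuous_on S (\<lambda>s. f (g s) (k s))"
  using continuous_on_compose2[OF assms(1) continuous_on_Pair[OF assms(2,3)]] assms(4) by auto

lemma at_within_halfline: "t > 0 \<Longrightarrow> at t within {0..} = at t" for t :: real
  by (rule at_within_interior) simp

lemma derivative_along_line:
  fixes f fx ft :: "real \<Rightarrow> real \<Rightarrow> real"
  assumes fx: "\<And>x t. x \<in> {0..1} \<Longrightarrow> t \<ge> 0 \<Longrightarrow>
      ((\<lambda>y. f y t) has_real_derivative fx x t) (at x within {0..1})"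
    and ft: "\<And>x t. x \<in> {0..1} \<Longrightarrow> t \<ge> 0 \<Longrightarrow>
      ((\<lambda>s. f x s) has_real_derivative ft x t) (at t within {0..})"
    and cft: "continuous_on ({0..1} \<times> {0..}) (\<lambda>(x, t). ft x t)"
    and S: "S \<subseteq> {0..1}" "\<And>y. y \<in> S \<Longrightarrow> A + B * y \<ge> 0" and x: "x \<in> S"
  shows "((\<lambda>y. f y (A + B * y)) has_real_derivative fx x (A + B * x) + B * ft x (A + B * x))
    (at x within S)"
proof -
  let ?t = "A + B * x"
  have Q: "x \<in> {0..1}" "?t \<in> {0..}" using S x by auto
  have "((\<lambda>(x, t). f x t) has_derivative (\<lambda>(dx, dt). fx x ?t * dx + blinfun_mult_right (ft x ?t) dt))
      (at (x, ?t) within {0..1} \<times> {0..})"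
  proof (rule has_derivative_partialsI[where fy = "\<lambda>x t. blinfun_mult_right (ft x t)"])
    show "((\<lambda>y. f y ?t) has_derivative (*) (fx x ?t)) (at x within {0..1})"
      using fx Q by (simp add: has_field_derivative_def)
    show "((\<lambda>s. f y s) has_derivative blinfun_apply (blinfun_mult_right (ft y t))) (at t within {0..})"
      if "y \<in> {0..1}" "t \<in> {0..}" for y t
      using ft[of y t] that by (simp add: has_field_derivative_def blinfun_mult_right.rep_eq)
    have "continuous_on ({0..1} \<times> {0..}) (\<lambda>z. blinfun_mult_right ((\<lambda>(y, t). ft y t) z))"
      by (rule bounded_linear.continuous_on[OF bounded_linear_blinfun_mult_right cft])
    then show "continuous (at (x, ?t) within {0..1} \<times> {0..}) (\<lambda>(y, t). blinfun_mult_right (ft y t))"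
      using Q unfolding continuous_on_eq_continuous_within case_prod_beta' by (auto dest!: bspec)
  qed (use Q in auto)
  then have 1: "((\<lambda>(x, t). f x t) has_derivative (\<lambda>(dx, dt). fx x ?t * dx + ft x ?t * dt))
      (at (x, ?t) within (\<lambda>y. (y, A + B * y)) ` S)"
    unfolding blinfun_mult_right.rep_eq by (rule has_derivative_subset) (use S in auto)
  have "((\<lambda>y. (y, A + B * y)) has_derivative (\<lambda>d. (d, B * d))) (at x within S)"
    by (auto intro!: derivative_eq_intros)
  from has_derivative_in_compose[OF this 1]
  have "((\<lambda>y. f y (A + B * y)) has_derivative (\<lambda>d. fx x ?t * d + ft x ?t * (B * d))) (at x within S)"
    by simp
  then show ?thesis unfolding has_field_derivative_def
    by (rule has_derivative_eq_rhs) (simp add: fun_eq_iff algebra_simps)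
qed

lemma time_derivative_integral:
  fixes f ft :: "real \<Rightarrow> real \<Rightarrow> real"
  assumes ft: "\<And>x t. x \<in> {0..1} \<Longrightarrow> t \<ge> 0 \<Longrightarrow>
      ((\<lambda>s. f x s) has_real_derivative ft x t) (at t within {0..})"
    and cf: "continuous_on ({0..1} \<times> {0..}) (\<lambda>(x, t). f x t)"
    and cft: "continuous_on ({0..1} \<times> {0..}) (\<lambda>(x, t). ft x t)"
    and I: "{x0..x1} \<subseteq> {0..1}" and \<sigma>: "continuous_on {x0..x1} \<sigma>"
    and t: "t1 < t" "\<And>y. y \<in> {x0..x1} \<Longrightarrow> t1 + \<sigma> y \<ge> 0"
  shows "((\<lambda>s. integral {x0..x1} (\<lambda>y. f y (s + \<sigma> y))) has_real_derivative
    integral {x0..x1} (\<lambda>y. ft y (t + \<sigma> y))) (at t)"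
proof -
  have pos: "s + \<sigma> y > 0" if "s \<in> {t1<..}" "y \<in> {x0..x1}" for s y
    using t(2)[OF that(2)] that(1) by simp
  have "((\<lambda>s. integral (cbox x0 x1) (\<lambda>y. f y (s + \<sigma> y))) has_real_derivative
    integral (cbox x0 x1) (\<lambda>y. ft y (t + \<sigma> y))) (at t within {t1<..})"
  proof (rule leibniz_rule_field_derivative)
    fix s y assume s: "s \<in> {t1<..}" and y: "y \<in> cbox x0 x1"
    have "s + \<sigma> y > 0" using pos s y by simp
    moreover from this have "(f y has_real_derivative ft y (s + \<sigma> y)) (at (s + \<sigma> y) within {0..})"
      using ft[of y "s + \<sigma> y"] I y by auto
    ultimately have "(f y has_real_derivative ft y (s + \<sigma> y)) (at (s + \<sigma> y))"
      using at_within_halfline[of "s + \<sigma> y"] by simp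
    then have "((\<lambda>s. f y (s + \<sigma> y)) has_real_derivative ft y (s + \<sigma> y)) (at s)"
      by (rule DERIV_shift[THEN iffD1])
    then show "((\<lambda>s. f y (s + \<sigma> y)) has_real_derivative ft y (s + \<sigma> y)) (at s within {t1<..})"
      by (rule has_field_derivative_at_within)
  next
    fix s assume "s \<in> {t1<..}"
    then show "(\<lambda>y. f y (s + \<sigma> y)) integrable_on cbox x0 x1"
      unfolding cbox_interval
      by (intro integrable_continuous_real continuous_on_curve[OF cf] continuous_intros \<sigma>)
         (use pos I in force)
  next
    show "continuous_on ({t1<..} \<times> cbox x0 x1) (\<lambda>(s, y). ft y (s + \<sigma> y))"
      unfolding case_prod_beta
    proof (rule continuous_on_curve[OF cft])
      show "continuous_on ({t1<..} \<times> cbox x0 x1) (\<lambda>z. fst z + \<sigma> (snd z))"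
        by (intro continuous_intros continuous_on_compose2[OF \<sigma>]) auto
      show "continuous_on ({t1<..} \<times> cbox x0 x1) snd" by (intro continuous_intros)
      show "snd z \<in> {0..1} \<and> fst z + \<sigma> (snd z) \<in> {0..}" if "z \<in> {t1<..} \<times> cbox x0 x1" for z
        using pos[of "fst z" "snd z"] I that by (auto simp: mem_Times_iff)
    qed
  qed (use t in auto)
  then show ?thesis using t(1) by (simp add: at_within_open[of _ "{t1<..}"])
qed

text \<open>
  The Cauchy-Schwarz inequality, from \<open>2 B \<bar>z\<bar> \<le> B\<^sup>2 + z\<^sup>2\<close>.
\<close>

lemma integral_abs_le_of_square:
  fixes f :: "real \<Rightarrow> real"
  assumes f: "continuous_on {0..1} f" and B: "B > 0" and le: "integral {0..1} (\<lambda>y. (f y)\<^sup>2) \<le> B\<^sup>2"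
  shows "integral {0..1} (\<lambda>y. \<bar>f y\<bar>) \<le> B"
proof -
  have "\<bar>z\<bar> \<le> B / 2 + z\<^sup>2 / (2 * B)" for z
  proof -
    have "0 \<le> (B - \<bar>z\<bar>)\<^sup>2" by simp
    then have "2 * B * \<bar>z\<bar> \<le> B\<^sup>2 + z\<^sup>2" by (simp add: power2_diff)
    then show ?thesis using B by (simp add: field_simps power2_eq_square)
  qed
  then have "integral {0..1} (\<lambda>y. \<bar>f y\<bar>) \<le> integral {0..1} (\<lambda>y. B / 2 + (f y)\<^sup>2 / (2 * B))"
    by (intro integral_le integrable_continuous_real continuous_intros f) (use B in auto)
  also have "\<dots> = B / 2 + integral {0..1} (\<lambda>y. (f y)\<^sup>2) / (2 * B)"
  proof -
    have "(\<lambda>y. (f y)\<^sup>2 / (2 * B)) integrable_on {0..1}"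
      using B by (intro integrable_continuous_real continuous_intros f) auto
    then show ?thesis by (subst integral_add) auto
  qed
  also have "\<dots> \<le> B / 2 + B\<^sup>2 / (2 * B)"
    using le B by (intro add_left_mono divide_right_mono) auto
  also have "\<dots> = B" using B by (simp add: power2_eq_square)
  finally show ?thesis .
qed

lemma abs_integral_le:
  fixes f :: "real \<Rightarrow> real"
  assumes "x0 \<le> x1" "{x0..x1} \<subseteq> {0..1}" "\<And>y. y \<in> {x0..x1} \<Longrightarrow> \<bar>f y\<bar> \<le> B"
    and "continuous_on {x0..x1} f"
  shows "\<bar>integral {x0..x1} f\<bar> \<le> B"
proof -
  have "x0 \<in> {x0..x1}" using assms(1) by simp
  then have "B \<ge> 0" using assms(3)[of x0] by force
  have "norm (integral {x0..x1} f) \<le> B * (x1 - x0)"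
    by (rule integral_bound) (use assms in auto)
  also have "\<dots> \<le> B * 1" using assms \<open>B \<ge> 0\<close> by (intro mult_left_mono) auto
  finally show ?thesis by simp
qed

lemma time_derivative_affine:
  fixes f f' :: "real \<Rightarrow> real"
  assumes f: "\<And>t. t \<ge> 0 \<Longrightarrow> ((\<lambda>s. f s) has_real_derivative f' t) (at t within {0..})"
    and S: "\<And>\<theta>. \<theta> \<in> S \<Longrightarrow> t0 + \<theta> * l \<ge> 0" "\<theta> \<in> S"
  shows "((\<lambda>\<theta>. f (t0 + \<theta> * l)) has_real_derivative f' (t0 + \<theta> * l) * l) (at \<theta> within S)"
proof -
  have "(f has_real_derivative f' (t0 + \<theta> * l)) (at (t0 + \<theta> * l) within (\<lambda>\<theta>. t0 + \<theta> * l) ` S)"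
    by (rule has_field_derivative_subset[OF f]) (use S in auto)
  moreover have "((\<lambda>\<theta>. t0 + \<theta> * l) has_real_derivative l) (at \<theta> within S)"
    by (auto intro!: derivative_eq_intros)
  ultimately show ?thesis
    using DERIV_image_chain[of f "f' (t0 + \<theta> * l)" "\<lambda>\<theta>. t0 + \<theta> * l" \<theta> S l] by (simp add: o_def)
qed

text \<open>
  The first order problem with the speed \<open>1/h\<close>, on the closed strip and solved for the \<open>x\<close>-derivatives;
  \<open>C\<close>, \<open>W\<close>, \<open>U\<close> are the families of derivatives of \<open>c\<close>, \<open>w\<close>, \<open>u\<close>.  Initial data are no part of it, so
  every time \<open>t\<^sub>0 \<ge> 0\<close> may serve as the initial one.
\<close>

locale wave_system =
  fixes h p \<epsilon> :: real and C W U :: "nat \<Rightarrow> nat \<Rightarrow> real \<Rightarrow> real \<Rightarrow> real"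
  assumes h: "h > 0" and eps: "0 \<le> \<epsilon>" "\<epsilon> \<le> 1"
    and C: "C2_family {0..1} {0..} C"
    and W: "C2_family {0..1} {0..} W"
    and U: "C2_family {0..1} {0..} U"
    and C_bound: "\<And>\<alpha> \<beta> x t. \<alpha> + \<beta> \<le> 2 \<Longrightarrow> x \<in> {0..1} \<Longrightarrow> t \<ge> 0 \<Longrightarrow> \<bar>C \<alpha> \<beta> x t\<bar> \<le> \<epsilon>"
    and w_x: "\<And>x t. x \<in> {0..1} \<Longrightarrow> t \<ge> 0 \<Longrightarrow>
      W (Suc 0) 0 x t = h * (U 0 0 x t - W 0 (Suc 0) x t)"
    and u_x: "\<And>x t. x \<in> {0..1} \<Longrightarrow> t \<ge> 0 \<Longrightarrow>
      U (Suc 0) 0 x t = h * (U 0 (Suc 0) x t + C 0 0 x t * W 0 0 x t)"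
    and w_left: "\<And>t. t \<ge> 0 \<Longrightarrow> W 0 0 0 t = p * U 0 0 0 t"
    and u_right: "\<And>t. t \<ge> 0 \<Longrightarrow> U 0 0 1 t = 0"
begin

abbreviation "c \<equiv> C 0 0"
abbreviation "c\<^sub>t \<equiv> C 0 (Suc 0)"
abbreviation "c\<^sub>x \<equiv> C (Suc 0) 0"
abbreviation "w \<equiv> W 0 0"
abbreviation "w\<^sub>t \<equiv> W 0 (Suc 0)"
abbreviation "w\<^sub>t\<^sub>t \<equiv> W 0 (Suc (Suc 0))"
abbreviation "u \<equiv> U 0 0"
abbreviation "u\<^sub>t \<equiv> U 0 (Suc 0)"
abbreviation "u\<^sub>t\<^sub>t \<equiv> U 0 (Suc (Suc 0))"

lemma curve_continuity:
  assumes "\<alpha> + \<beta> \<le> 2" "continuous_on S g" "continuous_on S k"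
    "\<And>s. s \<in> S \<Longrightarrow> g s \<in> {0..1} \<and> k s \<in> {0..}"
  shows "continuous_on S (\<lambda>s. C \<alpha> \<beta> (g s) (k s))" "continuous_on S (\<lambda>s. W \<alpha> \<beta> (g s) (k s))"
    "continuous_on S (\<lambda>s. U \<alpha> \<beta> (g s) (k s))"
  using continuous_on_curve[OF C2_family_continuous[OF C assms(1)] assms(2,3)]
    continuous_on_curve[OF C2_family_continuous[OF W assms(1)] assms(2,3)]
    continuous_on_curve[OF C2_family_continuous[OF U assms(1)] assms(2,3)] assms(4) by blast+

text \<open>
  The slope \<open>B = h\<close> is the characteristic one for \<open>w\<close>.  The other slopes express \<open>w\<^sub>t\<close> by derivatives of
  \<open>w\<close> along lines.
\<close>

lemma w_along_line:
  assumes "S \<subseteq> {0..1}" "\<And>y. y \<in> S \<Longrightarrow> A + B * y \<ge> 0" "x \<in> S"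
  shows "((\<lambda>y. w y (A + B * y)) has_real_derivative
      h * u x (A + B * x) + (B - h) * w\<^sub>t x (A + B * x)) (at x within S)"
proof -
  have "((\<lambda>y. w y (A + B * y)) has_real_derivative
      W (Suc 0) 0 x (A + B * x) + B * w\<^sub>t x (A + B * x)) (at x within S)"
    by (rule derivative_along_line[OF C2_family_x[OF W] C2_family_t[OF W] C2_family_continuous[OF W]])
       (use assms in auto)
  moreover have "W (Suc 0) 0 x (A + B * x) + B * w\<^sub>t x (A + B * x)
      = h * u x (A + B * x) + (B - h) * w\<^sub>t x (A + B * x)"
    using w_x[of x "A + B * x"] assms by (auto simp: left_diff_distrib right_diff_distrib)
  ultimately show ?thesis by simp
qed

lemma u_along_line:
  assumes "S \<subseteq> {0..1}" "\<And>y. y \<in> S \<Longrightarrow> A + B * y \<ge> 0" "x \<in> S"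
  shows "((\<lambda>y. u y (A + B * y)) has_real_derivative
      (h + B) * u\<^sub>t x (A + B * x) + h * c x (A + B * x) * w x (A + B * x)) (at x within S)"
proof -
  have "((\<lambda>y. u y (A + B * y)) has_real_derivative
      U (Suc 0) 0 x (A + B * x) + B * u\<^sub>t x (A + B * x)) (at x within S)"
    by (rule derivative_along_line[OF C2_family_x[OF U] C2_family_t[OF U] C2_family_continuous[OF U]])
       (use assms in auto)
  moreover have "U (Suc 0) 0 x (A + B * x) + B * u\<^sub>t x (A + B * x)
      = (h + B) * u\<^sub>t x (A + B * x) + h * c x (A + B * x) * w x (A + B * x)"
    using u_x[of x "A + B * x"] assms by (auto simp: distrib_left distrib_right)
  ultimately show ?thesis by simp
qed

text \<open>
  The characteristic of \<open>u\<close> through \<open>(x,t)\<close> reaches \<open>x = 1\<close>, where \<open>u\<close> vanishes, at the time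
  \<open>t - h (1 - x) \<ge> 0\<close>.
\<close>

lemma u_integral:
  assumes x: "x \<in> {0..1}" and t: "t \<ge> h"
  shows "u x t = - h * integral {x..1} (\<lambda>y. c y (t + h * (x - y)) * w y (t + h * (x - y)))"
proof -
  have nn: "(t + h * x) + (-h) * y \<ge> 0" if "y \<in> {x..1}" for y
  proof -
    have "h * y \<le> h * 1" "h * x \<ge> 0" using that x h by (auto intro!: mult_left_mono)
    then show ?thesis using t by simp
  qed
  have "((\<lambda>y. h * c y (t + h * (x - y)) * w y (t + h * (x - y))) has_integral
      u 1 ((t + h * x) + (-h) * 1) - u x ((t + h * x) + (-h) * x)) {x..1}"
  proof (rule fundamental_theorem_of_calculus)
    fix y assume "y \<in> {x..1}"
    with x nn show "((\<lambda>y. u y ((t + h * x) + (-h) * y)) has_vector_derivative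
        h * c y (t + h * (x - y)) * w y (t + h * (x - y))) (at y within {x..1})"
      using u_along_line[of "{x..1}" "t + h * x" "-h" y]
      by (simp add: has_real_derivative_iff_has_vector_derivative algebra_simps)
  qed (use x in simp)
  moreover have "u 1 ((t + h * x) + (-h) * 1) = 0" using u_right nn[of 1] x by simp
  ultimately have "((\<lambda>y. h * (c y (t + h * (x - y)) * w y (t + h * (x - y)))) has_integral - u x t) {x..1}"
    by (simp add: mult.assoc)
  from integral_unique[OF this] show ?thesis by simp
qed

lemma w_integral:
  assumes x: "x \<in> {0..1}" and t: "t \<ge> h"
  shows "w x t = p * u 0 (t - h * x) + h * integral {0..x} (\<lambda>y. u y (t + h * (y - x)))"
proof -
  have hx: "h * x \<le> h" "0 \<le> h * x" using x h by (auto simp: mult_left_le)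
  have nn: "(t - h * x) + h * y \<ge> 0" if "y \<in> {0..x}" for y
  proof -
    have "h * y \<ge> 0" using that h by simp
    with hx t show ?thesis by linarith
  qed
  have "((\<lambda>y. h * u y (t + h * (y - x))) has_integral
      w x ((t - h * x) + h * x) - w 0 ((t - h * x) + h * 0)) {0..x}"
  proof (rule fundamental_theorem_of_calculus)
    fix y assume "y \<in> {0..x}"
    with x nn show "((\<lambda>y. w y ((t - h * x) + h * y)) has_vector_derivative
        h * u y (t + h * (y - x))) (at y within {0..x})"
      using w_along_line[of "{0..x}" "t - h * x" "h" y]
      by (simp add: has_real_derivative_iff_has_vector_derivative algebra_simps)
  qed (use x in simp)
  moreover have "w 0 (t - h * x) = p * u 0 (t - h * x)" by (rule w_left) (use hx t in linarith)
  ultimately have "((\<lambda>y. h * u y (t + h * (y - x))) has_integral w x t - p * u 0 (t - h * x)) {0..x}"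
    by simp
  from integral_unique[OF this] show ?thesis by simp
qed

section \<open>Energy between a horizontal line and a characteristic\<close>

text \<open>
  The segments \<open>t = t\<^sub>0 + \<theta> (T - h y)\<close>, \<open>0 \<le> \<theta> \<le> 1\<close>, tilt the initial line onto the leftward
  characteristic that starts at \<open>(0, t\<^sub>0 + T)\<close>.  The weights of \<open>w\<^sup>2\<close> and \<open>k u\<^sup>2\<close> in the energy \<open>E \<theta>\<close> are
  the densities of their fluxes through the segment, so the \<open>\<theta>\<close>-derivative of the energy density is an exact
  \<open>y\<close>-derivative up to terms without derivatives.  The boundary terms have the good sign because of
  \<open>u(1,\<cdot>) = 0\<close>, \<open>w(0,\<cdot>) = p u(0,\<cdot>)\<close> and \<open>k \<ge> p\<^sup>2\<close>.  The weight \<open>1 - \<theta>\<close> of \<open>u\<^sup>2\<close> degenerates at the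
  characteristic, so the remaining terms are only bounded by \<open>A E / \<surd>(1 - \<theta>)\<close>; this is integrable in \<open>\<theta>\<close>,
  and a Gronwall argument with the integrating factor \<open>exp (2 A \<surd>(1 - \<theta>))\<close> concludes.
\<close>

lemma characteristic_energy:
  assumes t0: "t0 \<ge> 0" and T: "T \<ge> h"
  defines "k \<equiv> 1 + p\<^sup>2"
  shows "integral {0..1} (\<lambda>y. (w y (t0 + (T - h * y)))\<^sup>2)
    \<le> exp (2 * (T * (1 + k))) * integral {0..1} (\<lambda>y. (w y t0)\<^sup>2 + k * (u y t0)\<^sup>2)"
proof -
  define A where "A = T * (1 + k)"
  define l where "l y = T - h * y" for y
  define e where "e \<theta> y = (1 + \<theta>) * (w y (t0 + \<theta> * l y))\<^sup>2 + k * (1 - \<theta>) * (u y (t0 + \<theta> * l y))\<^sup>2" for \<theta> y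
  define e' where "e' \<theta> y =
      (w y (t0 + \<theta> * l y))\<^sup>2 + (1 + \<theta>) * (2 * w y (t0 + \<theta> * l y) * (w\<^sub>t y (t0 + \<theta> * l y) * l y))
      - k * (u y (t0 + \<theta> * l y))\<^sup>2 + k * (1 - \<theta>) * (2 * u y (t0 + \<theta> * l y) * (u\<^sub>t y (t0 + \<theta> * l y) * l y))"
    for \<theta> y
  define E where "E \<theta> = integral {0..1} (e \<theta>)" for \<theta>
  have k: "k \<ge> 1" "k \<ge> p\<^sup>2" by (auto simp: k_def)
  have l: "0 \<le> l y" "l y \<le> T" if "y \<in> {0..1}" for y
  proof -
    have "0 \<le> h * y" "h * y \<le> h * 1" using that h by (auto intro!: mult_left_mono)
    then show "0 \<le> l y" "l y \<le> T" using T by (auto simp: l_def)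
  qed
  have pos: "t0 + \<theta> * l y \<ge> 0" if "y \<in> {0..1}" "\<theta> \<in> {0..1}" for y \<theta>
    using t0 l[of y] that by auto
  have ce: "continuous_on {0..1} (e \<theta>)" if "\<theta> \<in> {0..1}" for \<theta>
    unfolding e_def l_def
    by (intro continuous_intros curve_continuity) (use pos that in \<open>auto simp: l_def\<close>)
  have dE: "(E has_real_derivative integral {0..1} (e' \<theta>)) (at \<theta> within {0..1})"
    if \<theta>: "\<theta> \<in> {0..1}" for \<theta>
  proof -
    have "((\<lambda>\<theta>. integral (cbox 0 1) (e \<theta>)) has_real_derivative integral (cbox 0 1) (e' \<theta>))
        (at \<theta> within {0..1})"
    proof (rule leibniz_rule_field_derivative)
      fix \<theta> y :: real assume \<theta>: "\<theta> \<in> {0..1}" and "y \<in> cbox 0 1"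
      then have y: "y \<in> {0..1}" by simp
      have [derivative_intros]: "((\<lambda>\<theta>. w y (t0 + \<theta> * l y)) has_real_derivative
          w\<^sub>t y (t0 + \<theta> * l y) * l y) (at \<theta> within {0..1})"
        by (rule time_derivative_affine[OF C2_family_t[OF W]]) (use pos y \<theta> in auto)
      have [derivative_intros]: "((\<lambda>\<theta>. u y (t0 + \<theta> * l y)) has_real_derivative
          u\<^sub>t y (t0 + \<theta> * l y) * l y) (at \<theta> within {0..1})"
        by (rule time_derivative_affine[OF C2_family_t[OF U]]) (use pos y \<theta> in auto)
      show "((\<lambda>\<theta>. e \<theta> y) has_real_derivative e' \<theta> y) (at \<theta> within {0..1})"
        unfolding e_def e'_def
        by (rule derivative_eq_intros refl)+ (simp add: algebra_simps power2_eq_square)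
    next
      fix \<theta> :: real assume "\<theta> \<in> {0..1}"
      then show "e \<theta> integrable_on cbox 0 1" using ce by (auto intro: integrable_continuous_real)
    next
      show "continuous_on ({0..1} \<times> cbox 0 1) (\<lambda>(\<theta>, y). e' \<theta> y)"
        unfolding e'_def case_prod_beta l_def
        by (intro continuous_intros curve_continuity) (use pos in \<open>auto simp: l_def\<close>)
    qed (use \<theta> in auto)
    then show ?thesis by (simp add: E_def[abs_def])
  qed
  have growth: "integral {0..1} (e' \<theta>) \<le> A / sqrt (1 - \<theta>) * E \<theta>" if "0 < \<theta>" "\<theta> < 1" for \<theta>
  proof -
    define r where "r = sqrt (1 - \<theta>)"
    have r: "r > 0" "r\<^sup>2 = 1 - \<theta>" "r \<le> 1" using that by (auto simp: r_def)
    have \<theta>: "\<theta> \<in> {0..1}" using that by simp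
    define W' where "W' y = w y (t0 + \<theta> * l y)" for y
    define U' where "U' y = u y (t0 + \<theta> * l y)" for y
    define c' where "c' y = c y (t0 + \<theta> * l y)" for y
    (* With a h = 1 as a hypothesis, the identity for the derivative of G below is a polynomial one. *)
    define a where "a = 1 / h"
    have a: "a * h = 1" "a > 0" using h by (auto simp: a_def)
    define G where "G y = - a * (l y * ((W' y)\<^sup>2 - k * (U' y)\<^sup>2))" for y
    define R where "R y = 2 * l y * W' y * U' y * (1 - k * c' y)" for y
    have lin: "t0 + \<theta> * l y = (t0 + \<theta> * T) + (- \<theta> * h) * y" for y
      by (simp add: l_def algebra_simps)
    (* G 1 - G 0 is the contribution of the two ends; R collects the terms without derivatives. *)
    have "((\<lambda>y. e' \<theta> y - R y) has_integral G 1 - G 0) {0..1}"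
    proof (rule fundamental_theorem_of_calculus)
      fix y :: real assume y: "y \<in> {0..1}"
      (* The segment has the slope - \<theta> h, so it is characteristic for u only at \<theta> = 1. *)
      have [derivative_intros]: "(W' has_real_derivative h * U' y + (- \<theta> * h - h) * w\<^sub>t y (t0 + \<theta> * l y))
          (at y within {0..1})"
        unfolding W'_def U'_def lin
        by (rule w_along_line) (use pos[OF _ \<theta>] y in \<open>auto simp: lin\<close>)
      have [derivative_intros]: "(U' has_real_derivative
          (h + - \<theta> * h) * u\<^sub>t y (t0 + \<theta> * l y) + h * c' y * W' y) (at y within {0..1})"
        unfolding W'_def U'_def c'_def lin
        by (rule u_along_line) (use pos[OF _ \<theta>] y in \<open>auto simp: lin\<close>)
      have [derivative_intros]: "(l has_real_derivative - h) (at y within {0..1})"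
        unfolding l_def by (auto intro!: derivative_eq_intros)
      define W\<^sub>t where "W\<^sub>t = w\<^sub>t y (t0 + \<theta> * l y)"
      define U\<^sub>t where "U\<^sub>t = u\<^sub>t y (t0 + \<theta> * l y)"
      have "(G has_real_derivative - a * (- h * ((W' y)\<^sup>2 - k * (U' y)\<^sup>2) + l y *
          (2 * W' y * (h * U' y + (- \<theta> * h - h) * W\<^sub>t)
            - k * (2 * U' y * ((h + - \<theta> * h) * U\<^sub>t + h * c' y * W' y))))) (at y within {0..1})"
        unfolding G_def by (auto intro!: derivative_eq_intros simp: W\<^sub>t_def U\<^sub>t_def)
      moreover have "- a * (- h * ((W' y)\<^sup>2 - k * (U' y)\<^sup>2) + l y *
          (2 * W' y * (h * U' y + (- \<theta> * h - h) * W\<^sub>t)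
            - k * (2 * U' y * ((h + - \<theta> * h) * U\<^sub>t + h * c' y * W' y)))) = e' \<theta> y - R y"
        unfolding e'_def R_def W'_def[symmetric] U'_def[symmetric] W\<^sub>t_def[symmetric] U\<^sub>t_def[symmetric]
        using a(1) by algebra
      ultimately have "(G has_real_derivative e' \<theta> y - R y) (at y within {0..1})" by simp
      then show "(G has_vector_derivative e' \<theta> y - R y) (at y within {0..1})"
        by (simp add: has_real_derivative_iff_has_vector_derivative)
    qed simp
    moreover have "G 1 - G 0 \<le> 0"
    proof -
      have "U' 1 = 0" using u_right pos[of 1 \<theta>] \<theta> by (simp add: U'_def)
      moreover have "W' 0 = p * U' 0" using w_left pos[of 0 \<theta>] \<theta> by (simp add: W'_def U'_def)
      ultimately have "G 1 - G 0 = - (a * l 1) * (W' 1)\<^sup>2 - (a * l 0) * ((k - p\<^sup>2) * (U' 0)\<^sup>2)"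
        by (simp add: G_def power_mult_distrib algebra_simps)
      moreover have "(a * l 1) * (W' 1)\<^sup>2 \<ge> 0" "(a * l 0) * ((k - p\<^sup>2) * (U' 0)\<^sup>2) \<ge> 0"
        using l[of 0] l[of 1] a k by auto
      ultimately show ?thesis by simp
    qed
    moreover have cR: "continuous_on {0..1} R"
      unfolding R_def W'_def U'_def c'_def l_def
      by (intro continuous_intros curve_continuity) (use pos \<theta> in \<open>auto simp: l_def\<close>)
    ultimately have "integral {0..1} (e' \<theta>) \<le> integral {0..1} R"
    proof -
      assume I: "((\<lambda>y. e' \<theta> y - R y) has_integral G 1 - G 0) {0..1}" and G: "G 1 - G 0 \<le> 0"
      have "((\<lambda>y. (e' \<theta> y - R y) + R y) has_integral (G 1 - G 0) + integral {0..1} R) {0..1}"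
        using integrable_continuous_real[OF cR] by (intro has_integral_add[OF I]) auto
      then have "integral {0..1} (e' \<theta>) = (G 1 - G 0) + integral {0..1} R"
        by (simp add: integral_unique)
      with G show ?thesis by simp
    qed
    also have "\<dots> \<le> integral {0..1} (\<lambda>y. A / r * e \<theta> y)"
    proof (rule integral_le)
      show "R integrable_on {0..1}" by (rule integrable_continuous_real[OF cR])
      show "(\<lambda>y. A / r * e \<theta> y) integrable_on {0..1}"
        by (intro integrable_continuous_real continuous_intros ce \<theta>)
      fix y :: real assume y: "y \<in> {0..1}"
      have "\<bar>c' y\<bar> \<le> 1" using C_bound[of 0 0 y] pos[OF y \<theta>] y eps by (force simp: c'_def)
      then have "\<bar>k * c' y\<bar> \<le> k * 1" using k by (simp add: abs_mult mult_left_mono)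
      then have "\<bar>1 - k * c' y\<bar> \<le> 1 + k" by linarith
      then have "\<bar>l y * (1 - k * c' y)\<bar> \<le> A"
        using l[OF y] unfolding abs_mult A_def by (intro mult_mono) auto
      then have "\<bar>2 * W' y * U' y\<bar> * \<bar>l y * (1 - k * c' y)\<bar> \<le> \<bar>2 * W' y * U' y\<bar> * A"
        by (intro mult_left_mono) auto
      moreover have "R y \<le> \<bar>2 * W' y * U' y\<bar> * \<bar>l y * (1 - k * c' y)\<bar>"
        unfolding R_def abs_mult[symmetric] by (rule order_trans[OF _ abs_ge_self]) (simp add: algebra_simps)
      ultimately have 1: "R y \<le> \<bar>2 * W' y * U' y\<bar> * A" by linarith
      have "0 \<le> (\<bar>W' y\<bar> - r * \<bar>U' y\<bar>)\<^sup>2" by simp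
      then have "r * \<bar>2 * W' y * U' y\<bar> \<le> (W' y)\<^sup>2 + r\<^sup>2 * (U' y)\<^sup>2"
        by (simp add: power2_diff power_mult_distrib abs_mult algebra_simps)
      also have "\<dots> \<le> (1 + \<theta>) * (W' y)\<^sup>2 + k * r\<^sup>2 * (U' y)\<^sup>2"
      proof (rule add_mono)
        show "(W' y)\<^sup>2 \<le> (1 + \<theta>) * (W' y)\<^sup>2" using that by (simp add: distrib_right)
        show "r\<^sup>2 * (U' y)\<^sup>2 \<le> k * r\<^sup>2 * (U' y)\<^sup>2"
          using k mult_right_mono[of 1 k "r\<^sup>2"] by (intro mult_right_mono) auto
      qed
      also have "\<dots> = e \<theta> y" by (simp add: e_def r W'_def U'_def)
      finally have "\<bar>2 * W' y * U' y\<bar> \<le> e \<theta> y / r" using r by (simp add: field_simps)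
      moreover have "A \<ge> 0" using T h k by (simp add: A_def)
      ultimately have "\<bar>2 * W' y * U' y\<bar> * A \<le> e \<theta> y / r * A" by (rule mult_right_mono)
      with 1 show "R y \<le> A / r * e \<theta> y" by (simp add: mult.commute)
    qed
    finally show ?thesis by (simp add: E_def r_def)
  qed
  have "E 1 * exp (2 * A * sqrt (1 - 1)) \<le> E 0 * exp (2 * A * sqrt (1 - 0))"
  proof (rule DERIV_nonpos_imp_decreasing_open[of 0 1 "\<lambda>\<theta>. E \<theta> * exp (2 * A * sqrt (1 - \<theta>))"])
    fix \<theta> :: real assume \<theta>: "0 < \<theta>" "\<theta> < 1"
    have "(E has_real_derivative integral {0..1} (e' \<theta>)) (at \<theta>)"
      using dE[of \<theta>] \<theta> at_within_Icc_at[of 0 \<theta> 1] by auto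
    moreover have "((\<lambda>\<theta>. exp (2 * A * sqrt (1 - \<theta>))) has_real_derivative
        (- A / sqrt (1 - \<theta>)) * exp (2 * A * sqrt (1 - \<theta>))) (at \<theta>)"
      using \<theta> by (auto intro!: derivative_eq_intros simp: divide_simps)
    ultimately have "((\<lambda>\<theta>. E \<theta> * exp (2 * A * sqrt (1 - \<theta>))) has_real_derivative
        (integral {0..1} (e' \<theta>) - A / sqrt (1 - \<theta>) * E \<theta>) * exp (2 * A * sqrt (1 - \<theta>))) (at \<theta>)"
      by (rule DERIV_mult[THEN DERIV_cong]) (simp add: algebra_simps)
    moreover have "(integral {0..1} (e' \<theta>) - A / sqrt (1 - \<theta>) * E \<theta>) * exp (2 * A * sqrt (1 - \<theta>)) \<le> 0"
      using growth[OF \<theta>] by (intro mult_nonpos_nonneg) auto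
    ultimately show "\<exists>y. ((\<lambda>\<theta>. E \<theta> * exp (2 * A * sqrt (1 - \<theta>))) has_real_derivative y) (at \<theta>) \<and> y \<le> 0"
      by blast
  next
    have "continuous_on {0..1} E"
      using dE by (rule DERIV_continuous_on)
    then show "continuous_on {0..1} (\<lambda>\<theta>. E \<theta> * exp (2 * A * sqrt (1 - \<theta>)))"
      by (intro continuous_intros)
  qed simp
  moreover have "E 1 = 2 * integral {0..1} (\<lambda>y. (w y (t0 + (T - h * y)))\<^sup>2)"
    by (simp add: E_def e_def[abs_def] l_def)
  moreover have "E 0 = integral {0..1} (\<lambda>y. (w y t0)\<^sup>2 + k * (u y t0)\<^sup>2)"
    by (simp add: E_def e_def[abs_def])
  moreover have "integral {0..1} (\<lambda>y. (w y (t0 + (T - h * y)))\<^sup>2) \<ge> 0"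
    by (rule integral_nonneg) (use pos[of _ 1] in
      \<open>auto intro!: integrable_continuous_real continuous_intros curve_continuity simp: l_def\<close>)
  ultimately show ?thesis by (simp add: A_def mult.commute)
qed

text \<open>
  In the formula for \<open>u\<close> the integral of \<open>\<bar>c w\<bar>\<close> over a characteristic is at most \<open>\<epsilon>\<close> times the
  \<open>L\<^sup>2\<close> norm of \<open>w\<close> there, which the energy at \<open>t\<^sub>0\<close> controls.
\<close>

lemma u_initial_bound:
  assumes t0: "t0 \<ge> 0" and N: "N > 0"
    and energy: "integral {0..1} (\<lambda>y. (w y t0)\<^sup>2 + (1 + p\<^sup>2) * (u y t0)\<^sup>2) \<le> N\<^sup>2"
    and x: "x \<in> {0..1}" and t: "t0 + h \<le> t" "t \<le> t0 + 12 * h"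
  shows "\<bar>u x t\<bar> \<le> h * exp (13 * h * (2 + p\<^sup>2)) * (\<epsilon> * N)"
proof -
  define T where "T = t - t0 + h * x"
  define k where "k = 1 + p\<^sup>2"
  have hx: "0 \<le> h * x" "h * x \<le> h" using x h by (auto simp: mult_left_le)
  have T: "h \<le> T" "T \<le> 13 * h" using t hx by (auto simp: T_def)
  have curve: "t0 + (T - h * y) = t + h * (x - y)" for y by (simp add: T_def algebra_simps)
  define B where "B = exp (T * (1 + k)) * N"
  have "B > 0" using N by (simp add: B_def)
  have pos: "t + h * (x - y) \<ge> 0" if "y \<in> {0..1}" for y
  proof -
    have "h * y \<le> h * 1" using that h by (intro mult_left_mono) auto
    then show ?thesis using t t0 hx by (simp add: algebra_simps)
  qed
  have cw: "continuous_on {0..1} (\<lambda>y. w y (t + h * (x - y)))"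
    by (intro continuous_intros curve_continuity) (use pos in auto)
  have cc: "continuous_on {0..1} (\<lambda>y. c y (t + h * (x - y)))"
    by (intro continuous_intros curve_continuity) (use pos in auto)
  have "integral {0..1} (\<lambda>y. (w y (t + h * (x - y)))\<^sup>2)
      \<le> exp (2 * (T * (1 + k))) * integral {0..1} (\<lambda>y. (w y t0)\<^sup>2 + k * (u y t0)\<^sup>2)"
    using characteristic_energy[OF t0 T(1)] unfolding curve k_def .
  also have "\<dots> \<le> exp (2 * (T * (1 + k))) * N\<^sup>2"
    using energy by (intro mult_left_mono) (auto simp: k_def)
  also have "\<dots> = B\<^sup>2"
    by (simp add: B_def power_mult_distrib power2_eq_square exp_add[symmetric])
  finally have L1: "integral {0..1} (\<lambda>y. \<bar>w y (t + h * (x - y))\<bar>) \<le> B"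
    by (rule integral_abs_le_of_square[OF cw \<open>B > 0\<close>])
  have sub: "{x..1} \<subseteq> {0..1}" using x by auto
  have "norm (integral {x..1} (\<lambda>y. c y (t + h * (x - y)) * w y (t + h * (x - y))))
      \<le> integral {x..1} (\<lambda>y. \<epsilon> * \<bar>w y (t + h * (x - y))\<bar>)"
  proof (rule integral_norm_bound_integral)
    show "(\<lambda>y. c y (t + h * (x - y)) * w y (t + h * (x - y))) integrable_on {x..1}"
      by (intro integrable_continuous_real continuous_intros continuous_on_subset[OF cw sub]
            continuous_on_subset[OF cc sub])
    show "(\<lambda>y. \<epsilon> * \<bar>w y (t + h * (x - y))\<bar>) integrable_on {x..1}"
      by (intro integrable_continuous_real continuous_intros continuous_on_subset[OF cw sub])
    show "norm (c y (t + h * (x - y)) * w y (t + h * (x - y))) \<le> \<epsilon> * \<bar>w y (t + h * (x - y))\<bar>"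
      if "y \<in> {x..1}" for y
      using C_bound[of 0 0 y "t + h * (x - y)"] pos[of y] that sub
      by (auto simp: abs_mult intro!: mult_right_mono)
  qed
  also have "\<dots> \<le> integral {0..1} (\<lambda>y. \<epsilon> * \<bar>w y (t + h * (x - y))\<bar>)"
    by (rule integral_subset_le[OF sub])
       (use eps in \<open>auto intro!: integrable_continuous_real continuous_intros
          continuous_on_subset[OF cw sub] cw\<close>)
  also have "\<dots> \<le> \<epsilon> * B" using L1 eps by (simp add: mult_left_mono)
  finally have "\<bar>u x t\<bar> \<le> h * (\<epsilon> * B)"
    using u_integral[OF x, of t] t t0 h by (simp add: abs_mult mult_left_mono)
  also have "\<dots> \<le> h * (\<epsilon> * (exp (13 * h * (2 + p\<^sup>2)) * N))"
  proof -
    have "T * (1 + k) \<le> 13 * h * (2 + p\<^sup>2)"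
      using T h by (auto simp: k_def intro!: mult_mono add_nonneg_nonneg)
    then show ?thesis using h eps N by (auto simp: B_def intro!: mult_left_mono mult_right_mono)
  qed
  finally show ?thesis by (simp add: ac_simps)
qed

section \<open>Gain of regularity\<close>

lemma transport_bound:
  fixes g :: "real \<Rightarrow> real \<Rightarrow> real"
  assumes x: "x \<in> {0..1}" and t: "t \<ge> h"
    and cg: "continuous_on ({0..1} \<times> {0..}) (\<lambda>(x, t). g x t)"
    and g: "\<And>y s. y \<in> {0..1} \<Longrightarrow> s \<in> {t - h..t} \<Longrightarrow> \<bar>g y s\<bar> \<le> B"
  shows "\<bar>p * g 0 (t - h * x) + h * integral {0..x} (\<lambda>y. g y (t + h * (y - x)))\<bar> \<le> (\<bar>p\<bar> + h) * B"
proof -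
  have hx: "h * x \<le> h" "0 \<le> h * x" using x h by (auto simp: mult_left_le)
  have s: "t + h * (y - x) \<in> {t - h..t}" if "y \<in> {0..x}" for y
  proof -
    have "0 \<le> h * y" "h * y \<le> h * x" using that h by auto
    then show ?thesis using hx by (simp add: algebra_simps)
  qed
  have "\<bar>integral {0..x} (\<lambda>y. g y (t + h * (y - x)))\<bar> \<le> B"
  proof (rule abs_integral_le)
    show "continuous_on {0..x} (\<lambda>y. g y (t + h * (y - x)))"
      by (intro continuous_intros continuous_on_curve[OF cg]) (use s t x in force)
  qed (use x s g in auto)
  moreover have "\<bar>g 0 (t - h * x)\<bar> \<le> B" using g[of 0 "t - h * x"] hx by auto
  ultimately have "\<bar>p\<bar> * \<bar>g 0 (t - h * x)\<bar> + h * \<bar>integral {0..x} (\<lambda>y. g y (t + h * (y - x)))\<bar>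
      \<le> \<bar>p\<bar> * B + h * B"
    using h by (intro add_mono mult_left_mono) auto
  moreover have "\<bar>p * g 0 (t - h * x) + h * integral {0..x} (\<lambda>y. g y (t + h * (y - x)))\<bar>
     \<le> \<bar>p\<bar> * \<bar>g 0 (t - h * x)\<bar> + h * \<bar>integral {0..x} (\<lambda>y. g y (t + h * (y - x)))\<bar>"
    using abs_triangle_ineq[of "p * g 0 (t - h * x)" "h * integral {0..x} (\<lambda>y. g y (t + h * (y - x)))"] h
    by (simp add: abs_mult)
  ultimately show ?thesis by (simp add: distrib_right)
qed

lemma time_derivative_at:
  assumes "t > 0" "x \<in> {0..1}" "\<alpha> + \<beta> < 2"
  shows "((\<lambda>s. C \<alpha> \<beta> x s) has_real_derivative C \<alpha> (Suc \<beta>) x t) (at t)"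
    "((\<lambda>s. W \<alpha> \<beta> x s) has_real_derivative W \<alpha> (Suc \<beta>) x t) (at t)"
    "((\<lambda>s. U \<alpha> \<beta> x s) has_real_derivative U \<alpha> (Suc \<beta>) x t) (at t)"
  using C2_family_t[OF C assms(3,2), of t] C2_family_t[OF W assms(3,2), of t]
    C2_family_t[OF U assms(3,2), of t] assms(1)
  by (simp_all add: at_within_halfline)

lemma time_derivative_shifted:
  assumes "t + s > 0" "x \<in> {0..1}" "\<alpha> + \<beta> < 2"
  shows "((\<lambda>t. C \<alpha> \<beta> x (t + s)) has_real_derivative C \<alpha> (Suc \<beta>) x (t + s)) (at t)"
    "((\<lambda>t. W \<alpha> \<beta> x (t + s)) has_real_derivative W \<alpha> (Suc \<beta>) x (t + s)) (at t)"
    "((\<lambda>t. U \<alpha> \<beta> x (t + s)) has_real_derivative U \<alpha> (Suc \<beta>) x (t + s)) (at t)"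
  using time_derivative_at[OF assms] by (auto intro: DERIV_shift[THEN iffD1])

text \<open>
  The formula for \<open>w\<close> contains \<open>t\<close> only as a shift, so it may be differentiated under the integral.
\<close>

lemma transport_derivative:
  assumes x: "x \<in> {0..1}" and t: "t > h" and \<beta>: "\<beta> < 2"
    and f: "\<And>s. s > h \<Longrightarrow>
      W 0 \<beta> x s = p * U 0 \<beta> 0 (s - h * x) + h * integral {0..x} (\<lambda>y. U 0 \<beta> y (s + h * (y - x)))"
  shows "W 0 (Suc \<beta>) x t = p * U 0 (Suc \<beta>) 0 (t - h * x)
      + h * integral {0..x} (\<lambda>y. U 0 (Suc \<beta>) y (t + h * (y - x)))"
proof -
  have hx: "h * x \<le> h" "0 \<le> h * x" using x h by (auto simp: mult_left_le)
  have I: "((\<lambda>s. integral {0..x} (\<lambda>y. U 0 \<beta> y (s + h * (y - x)))) has_real_derivative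
      integral {0..x} (\<lambda>y. U 0 (Suc \<beta>) y (t + h * (y - x)))) (at t)"
  proof (rule time_derivative_integral[where ?t1.0 = h])
    show "h + h * (y - x) \<ge> 0" if "y \<in> {0..x}" for y
    proof -
      have "h * y \<ge> 0" using that h by simp
      then show ?thesis using hx by (simp add: algebra_simps)
    qed
    show "((\<lambda>s. U 0 \<beta> y s) has_real_derivative U 0 (Suc \<beta>) y s) (at s within {0..})"
      if "y \<in> {0..1}" "s \<ge> 0" for y s using that \<beta> by (intro C2_family_t[OF U]) auto
  qed (use x t \<beta> in \<open>auto intro!: C2_family_continuous[OF U] continuous_intros\<close>)
  have "((\<lambda>s. p * U 0 \<beta> 0 (s + (- h * x)) + h * integral {0..x} (\<lambda>y. U 0 \<beta> y (s + h * (y - x))))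
      has_real_derivative p * U 0 (Suc \<beta>) 0 (t + (- h * x))
      + h * integral {0..x} (\<lambda>y. U 0 (Suc \<beta>) y (t + h * (y - x)))) (at t)"
    by (intro DERIV_add DERIV_cmult time_derivative_shifted I) (use hx t \<beta> in auto)
  then have 1: "((\<lambda>s. W 0 \<beta> x s) has_real_derivative p * U 0 (Suc \<beta>) 0 (t + (- h * x))
      + h * integral {0..x} (\<lambda>y. U 0 (Suc \<beta>) y (t + h * (y - x)))) (at t)"
    by (rule has_field_derivative_transform_within_open[of _ _ _ "{h<..}"]) (use t f in auto)
  have 2: "((\<lambda>s. W 0 \<beta> x s) has_real_derivative W 0 (Suc \<beta>) x t) (at t)"
    using time_derivative_at(2)[of t x 0 \<beta>] t h x \<beta> by simp
  show ?thesis using DERIV_unique[OF 2 1] by simp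
qed

lemma w_time_integral:
  assumes x: "x \<in> {0..1}" and t: "t > h" and \<beta>: "\<beta> \<le> 2"
  shows "W 0 \<beta> x t = p * U 0 \<beta> 0 (t - h * x) + h * integral {0..x} (\<lambda>y. U 0 \<beta> y (t + h * (y - x)))"
  using t \<beta>
proof (induction \<beta> arbitrary: t)
  case 0 then show ?case using w_integral[OF x] by simp
next
  case (Suc \<beta>) then show ?case using transport_derivative[OF x] by simp
qed

lemma w_bound:
  assumes x: "x \<in> {0..1}" and t: "t > h" and \<beta>: "\<beta> \<le> 2"
    and B: "\<And>y s. y \<in> {0..1} \<Longrightarrow> s \<in> {t - h..t} \<Longrightarrow> \<bar>U 0 \<beta> y s\<bar> \<le> B"
  shows "\<bar>W 0 \<beta> x t\<bar> \<le> (\<bar>p\<bar> + h) * B"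
  unfolding w_time_integral[OF x t \<beta>]
  by (rule transport_bound[OF x _ C2_family_continuous[OF U]]) (use t \<beta> B in auto)

lemma leftward_line_in_strip:
  assumes "x \<in> {0..1}" "t \<ge> h" "y \<in> {x..1}"
  shows "t + h * (x - y) \<ge> 0" "t + h * (x - y) \<in> {t - h..t}"
proof -
  have "h * (y - x) \<le> h * 1" "h * (y - x) \<ge> 0" using assms h by (auto intro!: mult_left_mono)
  then show "t + h * (x - y) \<ge> 0" "t + h * (x - y) \<in> {t - h..t}"
    using assms by (auto simp: algebra_simps)
qed

lemma continuous_on_leftward_line:
  assumes "x \<in> {0..1}" "t \<ge> h" "\<alpha> + \<beta> \<le> 2"
  shows "continuous_on {x..1} (\<lambda>y. C \<alpha> \<beta> y (t + h * (x - y)))"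
    "continuous_on {x..1} (\<lambda>y. W \<alpha> \<beta> y (t + h * (x - y)))"
    "continuous_on {x..1} (\<lambda>y. U \<alpha> \<beta> y (t + h * (x - y)))"
  by (intro curve_continuity[OF assms(3)] continuous_intros; use leftward_line_in_strip assms in force)+

text \<open>
  Differentiating the formula for \<open>u\<close> gives \<open>u\<^sub>t = - h \<integral> (c w)\<^sub>t\<close>.  Along the leftward characteristic
  \<open>d/dy w = h u - 2h w\<^sub>t\<close>, hence \<open>2h (c w)\<^sub>t = F - d/dy (c w)\<close> with \<open>F = c\<^sub>x w + h c u + h c\<^sub>t w\<close>, and the total
  derivative integrates to boundary values.  The result contains no derivative of \<open>w\<close> or \<open>u\<close>.
\<close>

lemma u_time_integral:
  assumes x: "x \<in> {0..1}" and t: "t > h"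
  shows "u\<^sub>t x t = (c 1 (t + h * (x - 1)) * w 1 (t + h * (x - 1)) - c x t * w x t) / 2
      - integral {x..1} (\<lambda>y. c\<^sub>x y (t + h * (x - y)) * w y (t + h * (x - y))
          + h * (c y (t + h * (x - y)) * u y (t + h * (x - y)))
          + h * (c\<^sub>t y (t + h * (x - y)) * w y (t + h * (x - y)))) / 2"
    (is "_ = _ - integral {x..1} ?F / 2")
proof -
  let ?s = "\<lambda>y. t + h * (x - y)"
  let ?P = "\<lambda>y. c\<^sub>t y (?s y) * w y (?s y) + c y (?s y) * w\<^sub>t y (?s y)"
  have "((\<lambda>s. integral {x..1} (\<lambda>y. c y (s + h * (x - y)) * w y (s + h * (x - y)))) has_real_derivative
      integral {x..1} ?P) (at t)"
  proof (rule time_derivative_integral[where ?t1.0 = h and f = "\<lambda>y s. c y s * w y s"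
        and ft = "\<lambda>y s. c\<^sub>t y s * w y s + c y s * w\<^sub>t y s"])
    show "((\<lambda>s. c y s * w y s) has_real_derivative c\<^sub>t y s * w y s + c y s * w\<^sub>t y s) (at s within {0..})"
      if "y \<in> {0..1}" "s \<ge> 0" for y s
      using DERIV_mult[OF C2_family_t[OF C, of 0 0 y s] C2_family_t[OF W, of 0 0 y s]] that
      by (simp add: algebra_simps)
    show "h + h * (x - y) \<ge> 0" if "y \<in> {x..1}" for y using leftward_line_in_strip[of x h y] x that by simp
  qed (use x t C2_family_continuous[OF C, of 0 0] C2_family_continuous[OF W, of 0 0]
        C2_family_continuous[OF C, of 0 1] C2_family_continuous[OF W, of 0 1]
      in \<open>auto simp: case_prod_beta intro!: continuous_intros\<close>)
  then have "((\<lambda>s. - h * integral {x..1} (\<lambda>y. c y (s + h * (x - y)) * w y (s + h * (x - y))))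
      has_real_derivative - h * integral {x..1} ?P) (at t)"
    by (rule DERIV_cmult)
  then have "((\<lambda>s. u x s) has_real_derivative - h * integral {x..1} ?P) (at t)"
    by (rule has_field_derivative_transform_within_open[of _ _ _ "{h<..}"])
       (use t u_integral[OF x] in auto)
  moreover have "((\<lambda>s. u x s) has_real_derivative u\<^sub>t x t) (at t)"
    using time_derivative_at(3)[of t x 0 0] t h x by simp
  ultimately have ut: "u\<^sub>t x t = - h * integral {x..1} ?P" using DERIV_unique by blast
  have lin: "?s y = (t + h * x) + (- h) * y" for y by (simp add: algebra_simps)
  have sub: "{x..1} \<subseteq> {0..1}" using x by auto
  have "((\<lambda>y. ?F y - 2 * h * ?P y) has_integral c 1 (?s 1) * w 1 (?s 1) - c x (?s x) * w x (?s x)) {x..1}"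
  proof (rule fundamental_theorem_of_calculus)
    fix y assume y: "y \<in> {x..1}"
    have nn: "(t + h * x) + (- h) * z \<ge> 0" if "z \<in> {x..1}" for z
      using leftward_line_in_strip[of x t z] x t that by (simp add: lin)
    have "((\<lambda>y. c y (?s y)) has_real_derivative c\<^sub>x y (?s y) + (- h) * c\<^sub>t y (?s y)) (at y within {x..1})"
      unfolding lin
      by (rule derivative_along_line[OF C2_family_x[OF C] C2_family_t[OF C] C2_family_continuous[OF C]])
         (use sub nn y in auto)
    moreover have "((\<lambda>y. w y (?s y)) has_real_derivative
        h * u y (?s y) + (- h - h) * w\<^sub>t y (?s y)) (at y within {x..1})"
      unfolding lin by (rule w_along_line) (use sub nn y in auto)
    ultimately have "((\<lambda>y. c y (?s y) * w y (?s y)) has_real_derivative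
        (c\<^sub>x y (?s y) + (- h) * c\<^sub>t y (?s y)) * w y (?s y)
        + (h * u y (?s y) + (- h - h) * w\<^sub>t y (?s y)) * c y (?s y)) (at y within {x..1})"
      by (rule DERIV_mult)
    then show "((\<lambda>y. c y (?s y) * w y (?s y)) has_vector_derivative ?F y - 2 * h * ?P y) (at y within {x..1})"
      unfolding has_real_derivative_iff_has_vector_derivative[symmetric]
      by (rule DERIV_cong) (simp add: algebra_simps)
  qed (use x in simp)
  then have "integral {x..1} (\<lambda>y. ?F y - 2 * h * ?P y) = c 1 (?s 1) * w 1 (?s 1) - c x t * w x t"
    by (simp add: integral_unique)
  moreover have "integral {x..1} (\<lambda>y. ?F y - 2 * h * ?P y) = integral {x..1} ?F - 2 * h * integral {x..1} ?P"
  proof (subst integral_diff)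
    show "?F integrable_on {x..1}" "(\<lambda>y. 2 * h * ?P y) integrable_on {x..1}"
      using x t by (intro integrable_continuous_real continuous_intros continuous_on_leftward_line; simp)+
  qed simp
  ultimately show ?thesis using ut by (simp add: field_simps)
qed

lemma product_bound: "\<bar>a\<bar> \<le> \<epsilon> \<Longrightarrow> \<bar>b\<bar> \<le> B \<Longrightarrow> \<bar>a * b\<bar> \<le> \<epsilon> * B" for a b B :: real
  unfolding abs_mult by (rule mult_mono) (use eps in auto)

lemma u_t_bound:
  assumes x: "x \<in> {0..1}" and t: "t > h"
    and B: "\<And>y s. y \<in> {0..1} \<Longrightarrow> s \<in> {t - h..t} \<Longrightarrow> \<bar>w y s\<bar> \<le> B \<and> \<bar>u y s\<bar> \<le> B"
  shows "\<bar>u\<^sub>t x t\<bar> \<le> (2 + h) * (\<epsilon> * B)"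
proof -
  let ?s = "\<lambda>y. t + h * (x - y)"
  have s: "?s y \<in> {t - h..t}" "?s y \<ge> 0" "y \<in> {0..1}" if "y \<in> {x..1}" for y
    using leftward_line_in_strip[OF x _ that] t that x by auto
  have pw: "\<bar>C \<alpha> \<beta> y (?s y) * w y (?s y)\<bar> \<le> \<epsilon> * B" "\<bar>C \<alpha> \<beta> y (?s y) * u y (?s y)\<bar> \<le> \<epsilon> * B"
    if "\<alpha> + \<beta> \<le> 2" "y \<in> {x..1}" for \<alpha> \<beta> y
    using s[OF that(2)] B[of y "?s y"] C_bound[OF that(1), of y "?s y"] by (auto intro!: product_bound)
  have "\<bar>integral {x..1} (\<lambda>y. c\<^sub>x y (?s y) * w y (?s y) + h * (c y (?s y) * u y (?s y))
          + h * (c\<^sub>t y (?s y) * w y (?s y)))\<bar> \<le> (1 + 2 * h) * (\<epsilon> * B)"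
  proof (rule abs_integral_le)
    fix y assume y: "y \<in> {x..1}"
    have "\<bar>h * (c y (?s y) * u y (?s y))\<bar> \<le> h * (\<epsilon> * B)" "\<bar>h * (c\<^sub>t y (?s y) * w y (?s y))\<bar> \<le> h * (\<epsilon> * B)"
      using pw(2)[of 0 0 y] pw(1)[of 0 1 y] y h by (simp_all add: abs_mult[of h])
    with pw(1)[of 1 0 y] y
    show "\<bar>c\<^sub>x y (?s y) * w y (?s y) + h * (c y (?s y) * u y (?s y))
          + h * (c\<^sub>t y (?s y) * w y (?s y))\<bar> \<le> (1 + 2 * h) * (\<epsilon> * B)"
      by (simp add: distrib_right)
  next
    show "continuous_on {x..1} (\<lambda>y. c\<^sub>x y (?s y) * w y (?s y) + h * (c y (?s y) * u y (?s y))
          + h * (c\<^sub>t y (?s y) * w y (?s y)))"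
      using x t by (intro continuous_intros continuous_on_leftward_line; simp)
  qed (use x in auto)
  moreover have "\<bar>c 1 (?s 1) * w 1 (?s 1)\<bar> \<le> \<epsilon> * B" "\<bar>c x t * w x t\<bar> \<le> \<epsilon> * B"
    using pw(1)[of 0 0 1] pw(1)[of 0 0 x] x by auto
  moreover have "\<bar>(a - b) / 2 - i / 2\<bar> \<le> e + k / 2" if "\<bar>i\<bar> \<le> k" "\<bar>a\<bar> \<le> e" "\<bar>b\<bar> \<le> e"
    for a b i e k :: real
    using that unfolding diff_divide_distrib by linarith
  ultimately have "\<bar>u\<^sub>t x t\<bar> \<le> \<epsilon> * B + (1 + 2 * h) * (\<epsilon> * B) / 2"
    unfolding u_time_integral[OF x t] by blast
  moreover have "\<epsilon> * B \<ge> 0" using pw(1)[of 0 0 x] x by force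
  ultimately show ?thesis by (simp add: field_simps)
qed

text \<open>
  The formula for \<open>u\<^sub>t\<close> contains only \<open>c\<close>, \<open>c\<^sub>x\<close>, \<open>c\<^sub>t\<close>, \<open>w\<close> and \<open>u\<close>, so it can be differentiated once more for
  \<open>c\<close> of class \<open>C\<^sup>2\<close>.
\<close>

lemma u_tt_bound:
  assumes x: "x \<in> {0..1}" and t: "t > h"
    and B: "\<And>y s. y \<in> {0..1} \<Longrightarrow> s \<in> {t - h..t} \<Longrightarrow>
      \<bar>w y s\<bar> \<le> B \<and> \<bar>u y s\<bar> \<le> B \<and> \<bar>w\<^sub>t y s\<bar> \<le> B \<and> \<bar>u\<^sub>t y s\<bar> \<le> B"
  shows "\<bar>u\<^sub>t\<^sub>t x t\<bar> \<le> (3 + 2 * h) * (\<epsilon> * B)"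
proof -
  let ?s = "\<lambda>y. t + h * (x - y)"
  define F where "F y s = c\<^sub>x y s * w y s + h * (c y s * u y s) + h * (c\<^sub>t y s * w y s)" for y s
  define F\<^sub>t where "F\<^sub>t y s = (C (Suc 0) (Suc 0) y s * w y s + c\<^sub>x y s * w\<^sub>t y s)
      + h * (c\<^sub>t y s * u y s + c y s * u\<^sub>t y s)
      + h * (C 0 (Suc (Suc 0)) y s * w y s + c\<^sub>t y s * w\<^sub>t y s)" for y s
  have s: "?s y \<in> {t - h..t}" "?s y \<ge> 0" "y \<in> {0..1}" if "y \<in> {x..1}" for y
    using leftward_line_in_strip[OF x _ that] t that x by auto
  have pw: "\<bar>C \<alpha> \<beta> y (?s y) * w y (?s y)\<bar> \<le> \<epsilon> * B" "\<bar>C \<alpha> \<beta> y (?s y) * u y (?s y)\<bar> \<le> \<epsilon> * B"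
      "\<bar>C \<alpha> \<beta> y (?s y) * w\<^sub>t y (?s y)\<bar> \<le> \<epsilon> * B" "\<bar>C \<alpha> \<beta> y (?s y) * u\<^sub>t y (?s y)\<bar> \<le> \<epsilon> * B"
    if "\<alpha> + \<beta> \<le> 2" "y \<in> {x..1}" for \<alpha> \<beta> y
    using s[OF that(2)] B[of y "?s y"] C_bound[OF that(1), of y "?s y"] by (auto intro!: product_bound)
  have prod_t: "((\<lambda>s. f s * g s) has_real_derivative f' * g s + f s * g') (at s within A)"
    if "(f has_real_derivative f') (at s within A)" "(g has_real_derivative g') (at s within A)"
    for f g :: "real \<Rightarrow> real" and f' g' s A
    using DERIV_mult[OF that] by (simp add: algebra_simps)
  have I: "((\<lambda>s. integral {x..1} (\<lambda>y. F y (s + h * (x - y)))) has_real_derivative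
      integral {x..1} (\<lambda>y. F\<^sub>t y (?s y))) (at t)"
  proof (rule time_derivative_integral[where ?t1.0 = h])
    show "(F y has_real_derivative F\<^sub>t y s) (at s within {0..})" if "y \<in> {0..1}" "s \<ge> 0" for y s
      unfolding F_def F\<^sub>t_def
      by (intro DERIV_add DERIV_cmult prod_t C2_family_t[OF C] C2_family_t[OF W] C2_family_t[OF U])
         (use that in auto)
    show "h + h * (x - y) \<ge> 0" if "y \<in> {x..1}" for y using leftward_line_in_strip[of x h y] x that by simp
    show "continuous_on ({0..1} \<times> {0..}) (\<lambda>(x, t). F x t)"
      unfolding F_def case_prod_beta
      by (intro continuous_intros curve_continuity) auto
    show "continuous_on ({0..1} \<times> {0..}) (\<lambda>(x, t). F\<^sub>t x t)"
      unfolding F\<^sub>t_def case_prod_beta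
      by (intro continuous_intros curve_continuity) auto
  qed (use x t in \<open>auto intro!: continuous_intros\<close>)
  have J: "((\<lambda>s. c y (s + h * (x - y)) * w y (s + h * (x - y))) has_real_derivative
      c\<^sub>t y (?s y) * w y (?s y) + c y (?s y) * w\<^sub>t y (?s y)) (at t)" if "y \<in> {x..1}" for y
  proof -
    have "t + h * (x - y) > 0" using leftward_line_in_strip[of x h y] x that t by simp
    then show ?thesis by (intro prod_t time_derivative_shifted) (use that x in auto)
  qed
  have "((\<lambda>s. ((c 1 (s + h * (x - 1)) * w 1 (s + h * (x - 1))) - c x s * w x s) / 2
        - integral {x..1} (\<lambda>y. F y (s + h * (x - y))) / 2) has_real_derivative
      ((c\<^sub>t 1 (?s 1) * w 1 (?s 1) + c 1 (?s 1) * w\<^sub>t 1 (?s 1)) - (c\<^sub>t x t * w x t + c x t * w\<^sub>t x t)) / 2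
        - integral {x..1} (\<lambda>y. F\<^sub>t y (?s y)) / 2) (at t)"
    using J[of 1] J[of x] x by (intro DERIV_diff DERIV_cdivide I) auto
  then have "((\<lambda>s. u\<^sub>t x s) has_real_derivative
      ((c\<^sub>t 1 (?s 1) * w 1 (?s 1) + c 1 (?s 1) * w\<^sub>t 1 (?s 1)) - (c\<^sub>t x t * w x t + c x t * w\<^sub>t x t)) / 2
        - integral {x..1} (\<lambda>y. F\<^sub>t y (?s y)) / 2) (at t)"
    by (rule has_field_derivative_transform_within_open[of _ _ _ "{h<..}"])
       (use t u_time_integral[OF x] in \<open>auto simp: F_def\<close>)
  moreover have "((\<lambda>s. u\<^sub>t x s) has_real_derivative u\<^sub>t\<^sub>t x t) (at t)"
    using time_derivative_at(3)[of t x 0 1] t h x by simp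
  ultimately have utt: "u\<^sub>t\<^sub>t x t =
      ((c\<^sub>t 1 (?s 1) * w 1 (?s 1) + c 1 (?s 1) * w\<^sub>t 1 (?s 1)) - (c\<^sub>t x t * w x t + c x t * w\<^sub>t x t)) / 2
        - integral {x..1} (\<lambda>y. F\<^sub>t y (?s y)) / 2"
    using DERIV_unique by blast
  have "\<bar>integral {x..1} (\<lambda>y. F\<^sub>t y (?s y))\<bar> \<le> (2 + 4 * h) * (\<epsilon> * B)"
  proof (rule abs_integral_le)
    fix y assume y: "y \<in> {x..1}"
    have "\<bar>c\<^sub>t y (?s y) * u y (?s y) + c y (?s y) * u\<^sub>t y (?s y)\<bar> \<le> 2 * (\<epsilon> * B)"
      "\<bar>C 0 (Suc (Suc 0)) y (?s y) * w y (?s y) + c\<^sub>t y (?s y) * w\<^sub>t y (?s y)\<bar> \<le> 2 * (\<epsilon> * B)"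
      using pw(2)[of 0 "Suc 0" y] pw(4)[of 0 0 y] pw(1)[of 0 "Suc (Suc 0)" y] pw(3)[of 0 "Suc 0" y] y
      by auto
    then have "\<bar>h * (c\<^sub>t y (?s y) * u y (?s y) + c y (?s y) * u\<^sub>t y (?s y))\<bar> \<le> h * (2 * (\<epsilon> * B))"
      "\<bar>h * (C 0 (Suc (Suc 0)) y (?s y) * w y (?s y) + c\<^sub>t y (?s y) * w\<^sub>t y (?s y))\<bar> \<le> h * (2 * (\<epsilon> * B))"
      using h by (simp_all add: abs_mult[of h])
    with pw(1)[of "Suc 0" "Suc 0" y] pw(3)[of "Suc 0" 0 y] y
    show "\<bar>F\<^sub>t y (?s y)\<bar> \<le> (2 + 4 * h) * (\<epsilon> * B)"
      unfolding F\<^sub>t_def by (simp add: distrib_right)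
  next
    show "continuous_on {x..1} (\<lambda>y. F\<^sub>t y (?s y))"
      unfolding F\<^sub>t_def using x t by (intro continuous_intros continuous_on_leftward_line; simp)
  qed (use x in auto)
  moreover have "\<bar>c\<^sub>t 1 (?s 1) * w 1 (?s 1)\<bar> \<le> \<epsilon> * B" "\<bar>c 1 (?s 1) * w\<^sub>t 1 (?s 1)\<bar> \<le> \<epsilon> * B"
      "\<bar>c\<^sub>t x t * w x t\<bar> \<le> \<epsilon> * B" "\<bar>c x t * w\<^sub>t x t\<bar> \<le> \<epsilon> * B"
    using pw(1)[of 0 "Suc 0" 1] pw(1)[of 0 "Suc 0" x] pw(3)[of 0 0 1] pw(3)[of 0 0 x] x by auto
  moreover have "\<bar>((a\<^sub>1 + a\<^sub>2) - (a\<^sub>3 + a\<^sub>4)) / 2 - i / 2\<bar> \<le> 2 * e + k / 2"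
    if "\<bar>i\<bar> \<le> k" "\<bar>a\<^sub>1\<bar> \<le> e" "\<bar>a\<^sub>2\<bar> \<le> e" "\<bar>a\<^sub>3\<bar> \<le> e" "\<bar>a\<^sub>4\<bar> \<le> e" for a\<^sub>1 a\<^sub>2 a\<^sub>3 a\<^sub>4 i e k :: real
    using that unfolding diff_divide_distrib add_divide_distrib by linarith
  ultimately have "\<bar>u\<^sub>t\<^sub>t x t\<bar> \<le> 2 * (\<epsilon> * B) + (2 + 4 * h) * (\<epsilon> * B) / 2"
    unfolding utt by blast
  also have "\<dots> = (3 + 2 * h) * (\<epsilon> * B)" by (simp add: field_simps)
  finally show ?thesis .
qed

end

text \<open>
  The exponential comes from the energy estimate over characteristics that reach at most \<open>13h\<close> above
  the initial line; the three factors \<open>1 + \<bar>p\<bar> + h\<close> from the three transports from \<open>u\<close>, \<open>u\<^sub>t\<close>, \<open>u\<^sub>t\<^sub>t\<close> to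
  \<open>w\<close>, \<open>w\<^sub>t\<close>, \<open>w\<^sub>t\<^sub>t\<close>; the two factors \<open>3 + 2h\<close> from the two gains of a time derivative; and
  \<open>(1 + 2h)\<^sup>2\<close> from expressing \<open>x\<close>-derivatives by \<open>t\<close>-derivatives.
\<close>

definition window_const :: "real \<Rightarrow> real \<Rightarrow> real" where
  "window_const h p = (1 + 2 * h)\<^sup>2 * ((1 + \<bar>p\<bar> + h) ^ 3 * (3 + 2 * h)\<^sup>2
      * (h * exp (13 * h * (2 + p\<^sup>2))))"

lemma window_const_pos: "h > 0 \<Longrightarrow> window_const h p > 0"
  unfolding window_const_def by (auto intro!: mult_pos_pos add_pos_nonneg)

context wave_system
begin

text \<open>
  The interval ends at \<open>t\<^sub>0 + 12h\<close>, where the bounds with \<open>t\<^sub>0 + 6h\<close> as the initial time take over.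
  The factor \<open>\<epsilon>\<close> of the first bound for \<open>u\<close> survives to the end;
  in the later steps only \<open>\<epsilon> \<le> 1\<close> is used.
\<close>

lemma window_bounds:
  assumes t0: "t0 \<ge> 0" and N: "N > 0"
    and energy: "integral {0..1} (\<lambda>y. (w y t0)\<^sup>2 + (1 + p\<^sup>2) * (u y t0)\<^sup>2) \<le> N\<^sup>2"
    and x: "x \<in> {0..1}" and t: "t \<in> {t0 + 6 * h..t0 + 12 * h}"
  shows "\<bar>u x t\<bar> \<le> window_const h p * \<epsilon> * N"
    and "\<alpha> + \<beta> \<le> 2 \<Longrightarrow> \<bar>W \<alpha> \<beta> x t\<bar> \<le> window_const h p * \<epsilon> * N"
proof -
  define m where "m = 1 + \<bar>p\<bar> + h"
  define q where "q = 3 + 2 * h"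
  have m: "m \<ge> 1" "\<bar>p\<bar> + h \<le> m" using h by (auto simp: m_def)
  have q: "q \<ge> 1" "2 + h \<le> q" "3 + 2 * h \<le> q" using h by (auto simp: q_def)
  define B\<^sub>1 where "B\<^sub>1 = h * exp (13 * h * (2 + p\<^sup>2)) * (\<epsilon> * N)"
  have B\<^sub>1: "B\<^sub>1 \<ge> 0" using h eps N by (simp add: B\<^sub>1_def)
  have scale: "z \<le> r * B" if "z \<le> B" "1 \<le> r" "0 \<le> B" for z r B :: real
    using that mult_right_mono[of 1 r B] by linarith
  have absorb: "z \<le> q * B" if "z \<le> r * (\<epsilon> * B)" "r \<le> q" "0 \<le> r" "0 \<le> B" for z r B :: real
  proof -
    have "r * (\<epsilon> * B) \<le> q * (1 * B)" using that eps by (intro mult_mono mult_right_mono) auto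
    with that show ?thesis by simp
  qed
  have transport: "\<bar>W 0 \<beta> y s\<bar> \<le> m * B"
    if "y \<in> {0..1}" "s > h" "\<beta> \<le> 2" "0 \<le> B"
      "\<And>z r. z \<in> {0..1} \<Longrightarrow> r \<in> {s - h..s} \<Longrightarrow> \<bar>U 0 \<beta> z r\<bar> \<le> B" for \<beta> y s B
  proof -
    have "\<bar>W 0 \<beta> y s\<bar> \<le> (\<bar>p\<bar> + h) * B" by (rule w_bound) (use that in auto)
    also have "\<dots> \<le> m * B" using m that by (intro mult_right_mono) auto
    finally show ?thesis .
  qed
  have u1: "\<bar>u y s\<bar> \<le> B\<^sub>1" if "y \<in> {0..1}" "s \<in> {t0 + h..t0 + 12 * h}" for y s
    unfolding B\<^sub>1_def by (rule u_initial_bound[OF t0 N energy]) (use that in auto)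
  define B\<^sub>2 where "B\<^sub>2 = m * B\<^sub>1"
  have B\<^sub>2: "B\<^sub>2 \<ge> 0" using B\<^sub>1 m by (simp add: B\<^sub>2_def)
  have w2: "\<bar>w y s\<bar> \<le> B\<^sub>2" if "y \<in> {0..1}" "s \<in> {t0 + 2 * h..t0 + 12 * h}" for y s
    unfolding B\<^sub>2_def by (rule transport) (use that h t0 B\<^sub>1 u1 in auto)
  have u2: "\<bar>u y s\<bar> \<le> B\<^sub>2" if "y \<in> {0..1}" "s \<in> {t0 + h..t0 + 12 * h}" for y s
    unfolding B\<^sub>2_def by (rule scale) (use that u1 B\<^sub>1 m in auto)
  define B\<^sub>3 where "B\<^sub>3 = q * B\<^sub>2"
  have B\<^sub>3: "B\<^sub>3 \<ge> B\<^sub>2" "B\<^sub>3 \<ge> 0" using B\<^sub>2 q scale[of B\<^sub>2 B\<^sub>2 q] by (auto simp: B\<^sub>3_def)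
  have u3: "\<bar>u\<^sub>t y s\<bar> \<le> B\<^sub>3" if "y \<in> {0..1}" "s \<in> {t0 + 3 * h..t0 + 12 * h}" for y s
    unfolding B\<^sub>3_def
  proof (rule absorb)
    show "\<bar>u\<^sub>t y s\<bar> \<le> (2 + h) * (\<epsilon> * B\<^sub>2)"
      by (rule u_t_bound) (use that h t0 w2 u2 in auto)
  qed (use q h B\<^sub>2 in auto)
  define B\<^sub>4 where "B\<^sub>4 = m * B\<^sub>3"
  have B\<^sub>4: "B\<^sub>4 \<ge> B\<^sub>3" "B\<^sub>4 \<ge> 0" using B\<^sub>3 m scale[of B\<^sub>3 B\<^sub>3 m] by (auto simp: B\<^sub>4_def)
  have w4: "\<bar>w\<^sub>t y s\<bar> \<le> B\<^sub>4" if "y \<in> {0..1}" "s \<in> {t0 + 4 * h..t0 + 12 * h}" for y s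
    unfolding B\<^sub>4_def by (rule transport) (use that h t0 B\<^sub>3 u3 in auto)
  define B\<^sub>5 where "B\<^sub>5 = q * B\<^sub>4"
  have B\<^sub>5: "B\<^sub>5 \<ge> B\<^sub>4" "B\<^sub>5 \<ge> 0" using B\<^sub>4 q scale[of B\<^sub>4 B\<^sub>4 q] by (auto simp: B\<^sub>5_def)
  have u5: "\<bar>u\<^sub>t\<^sub>t y s\<bar> \<le> B\<^sub>5" if "y \<in> {0..1}" "s \<in> {t0 + 5 * h..t0 + 12 * h}" for y s
    unfolding B\<^sub>5_def
  proof (rule absorb)
    show "\<bar>u\<^sub>t\<^sub>t y s\<bar> \<le> (3 + 2 * h) * (\<epsilon> * B\<^sub>4)"
    proof (rule u_tt_bound)
      fix z r :: real assume "z \<in> {0..1}" "r \<in> {s - h..s}"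
      then have "z \<in> {0..1}" "r \<in> {t0 + 4 * h..t0 + 12 * h}" using that by auto
      then show "\<bar>w z r\<bar> \<le> B\<^sub>4 \<and> \<bar>u z r\<bar> \<le> B\<^sub>4 \<and> \<bar>w\<^sub>t z r\<bar> \<le> B\<^sub>4 \<and> \<bar>u\<^sub>t z r\<bar> \<le> B\<^sub>4"
        using w2[of z r] u2[of z r] w4[of z r] u3[of z r] B\<^sub>3 B\<^sub>4 h by auto
    qed (use that h t0 in auto)
  qed (use q h B\<^sub>4 in auto)
  define B where "B = m * B\<^sub>5"
  have B: "B \<ge> B\<^sub>5" "B \<ge> 0" using B\<^sub>5 m scale[of B\<^sub>5 B\<^sub>5 m] by (auto simp: B_def)
  have w6: "\<bar>w\<^sub>t\<^sub>t x t\<bar> \<le> B"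
    unfolding B_def by (rule transport) (use x t h t0 B\<^sub>5 u5 in auto)
  have t': "t \<ge> 0" using t t0 h by auto
  have base: "\<bar>w x t\<bar> \<le> B" "\<bar>u x t\<bar> \<le> B" "\<bar>w\<^sub>t x t\<bar> \<le> B" "\<bar>u\<^sub>t x t\<bar> \<le> B"
    using w2[of x t] u2[of x t] w4[of x t] u3[of x t] x t h B\<^sub>3 B\<^sub>4 B\<^sub>5 B by auto
  have sum2: "\<bar>h * (a - b)\<bar> \<le> 2 * h * d" "\<bar>h * (a + b)\<bar> \<le> 2 * h * d" if "\<bar>a\<bar> \<le> d" "\<bar>b\<bar> \<le> d" for a b d
  proof -
    have "\<bar>a - b\<bar> \<le> 2 * d" "\<bar>a + b\<bar> \<le> 2 * d" using that by auto
    then have "h * \<bar>a - b\<bar> \<le> h * (2 * d)" "h * \<bar>a + b\<bar> \<le> h * (2 * d)"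
      using h by (auto intro: mult_left_mono)
    then show "\<bar>h * (a - b)\<bar> \<le> 2 * h * d" "\<bar>h * (a + b)\<bar> \<le> 2 * h * d" using h by (auto simp: abs_mult)
  qed
  have wx: "\<bar>W (Suc 0) 0 x t\<bar> \<le> 2 * h * B"
    unfolding w_x[OF x t'] using base by (intro sum2)
  have ux: "\<bar>U (Suc 0) 0 x t\<bar> \<le> 2 * h * B"
    unfolding u_x[OF x t']
  proof (intro sum2 base)
    have "\<bar>c x t * w x t\<bar> \<le> \<epsilon> * B" using C_bound[of 0 0 x t] x t' base by (intro product_bound) auto
    also have "\<dots> \<le> 1 * B" using eps B by (intro mult_right_mono) auto
    finally show "\<bar>c x t * w x t\<bar> \<le> B" by simp
  qed
  have "((\<lambda>s. W (Suc 0) 0 x s) has_real_derivative h * (u\<^sub>t x t - w\<^sub>t\<^sub>t x t)) (at t within {0..})"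
  proof (rule has_real_derivative_transform)
    show "((\<lambda>s. h * (u x s - w\<^sub>t x s)) has_real_derivative h * (u\<^sub>t x t - w\<^sub>t\<^sub>t x t)) (at t within {0..})"
      by (intro DERIV_cmult DERIV_diff C2_family_t[OF U] C2_family_t[OF W]) (use x t' in auto)
  qed (use w_x x t' in auto)
  moreover have "((\<lambda>s. W (Suc 0) 0 x s) has_real_derivative W (Suc 0) (Suc 0) x t) (at t within {0..})"
    by (rule C2_family_t[OF W]) (use x t' in auto)
  ultimately have wxt: "W (Suc 0) (Suc 0) x t = h * (u\<^sub>t x t - w\<^sub>t\<^sub>t x t)"
    using has_field_derivative_unique at_within_nonbot(2)[of t] t' by (metis atLeast_iff)
  then have wxt_le: "\<bar>W (Suc 0) (Suc 0) x t\<bar> \<le> 2 * h * B" using base w6 by (simp add: sum2)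
  have "((\<lambda>y. W (Suc 0) 0 y t) has_real_derivative h * (U (Suc 0) 0 x t - W (Suc 0) (Suc 0) x t)) (at x within {0..1})"
  proof (rule has_real_derivative_transform)
    show "((\<lambda>y. h * (u y t - w\<^sub>t y t)) has_real_derivative h * (U (Suc 0) 0 x t - W (Suc 0) (Suc 0) x t))
        (at x within {0..1})"
      by (intro DERIV_cmult DERIV_diff C2_family_x[OF U] C2_family_x[OF W]) (use x t' in auto)
  qed (use w_x x t' in auto)
  moreover have "((\<lambda>y. W (Suc 0) 0 y t) has_real_derivative W (Suc (Suc 0)) 0 x t) (at x within {0..1})"
    by (rule C2_family_x[OF W]) (use x t' in auto)
  ultimately have "W (Suc (Suc 0)) 0 x t = h * (U (Suc 0) 0 x t - W (Suc 0) (Suc 0) x t)"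
    using has_field_derivative_unique at_within_nonbot(1)[OF x] by metis
  then have wxx: "\<bar>W (Suc (Suc 0)) 0 x t\<bar> \<le> 2 * h * (2 * h * B)"
    using sum2(1)[OF ux wxt_le] by simp
  have K: "window_const h p * \<epsilon> * N = (1 + 2 * h)\<^sup>2 * B"
    by (simp add: window_const_def B_def B\<^sub>5_def B\<^sub>4_def B\<^sub>3_def B\<^sub>2_def B\<^sub>1_def m_def q_def
        power2_eq_square power3_eq_cube)
  have "(1 + 2 * h)\<^sup>2 * B = B + 2 * (2 * h * B) + 2 * h * (2 * h * B)"
    by (simp add: power2_eq_square algebra_simps)
  moreover have "2 * h * B \<ge> 0" "2 * h * (2 * h * B) \<ge> 0" using B h by auto
  ultimately have K': "B \<le> window_const h p * \<epsilon> * N" "2 * h * B \<le> window_const h p * \<epsilon> * N"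
      "2 * h * (2 * h * B) \<le> window_const h p * \<epsilon> * N"
    unfolding K using B by linarith+
  show "\<bar>u x t\<bar> \<le> window_const h p * \<epsilon> * N" using order_trans[OF base(2) K'(1)] .
  assume "\<alpha> + \<beta> \<le> 2"
  then have "(\<alpha>, \<beta>) \<in> {(0,0), (0,Suc 0), (0,Suc (Suc 0)), (Suc 0,0), (Suc 0,Suc 0), (Suc (Suc 0),0)}"
    by auto
  then show "\<bar>W \<alpha> \<beta> x t\<bar> \<le> window_const h p * \<epsilon> * N"
    using order_trans[OF base(1) K'(1)] order_trans[OF base(3) K'(1)] order_trans[OF w6 K'(1)]
      order_trans[OF wx K'(2)] order_trans[OF wxt_le K'(2)] order_trans[OF wxx K'(3)]
    by (elim insertE) simp_all
qed

section \<open>Exponential decay of regular solutions\<close>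

text \<open>
  By the smallness of \<open>\<epsilon>\<close>, the square root of the energy decreases by the factor \<open>exp (- 6h\<gamma>)\<close> over a window.  A
  time \<open>t\<close> in the window that follows \<open>6hn\<close> by \<open>6h\<close> to \<open>12h\<close> is at most \<open>6h (n+2)\<close>, whereas only \<open>n+1\<close>
  factors have been collected; the constant \<open>exp (6h\<gamma>)\<close> makes up for the difference.
\<close>

lemma exponential_decay:
  assumes N: "N > 0" and small: "(2 + p\<^sup>2) * window_const h p * \<epsilon> \<le> exp (- \<gamma> * (6 * h))"
    and energy: "integral {0..1} (\<lambda>y. (w y 0)\<^sup>2 + (1 + p\<^sup>2) * (u y 0)\<^sup>2) \<le> N\<^sup>2"
    and \<gamma>: "\<gamma> > 0" and x: "x \<in> {0..1}" and t: "t \<ge> 6 * h" and \<alpha>\<beta>: "\<alpha> + \<beta> \<le> 2"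
  shows "\<bar>W \<alpha> \<beta> x t\<bar> \<le> exp (6 * h * \<gamma>) * exp (- \<gamma> * t) * N"
proof -
  define q where "q = exp (- \<gamma> * (6 * h))"
  have q: "q > 0" by (simp add: q_def)
  have KK: "0 \<le> window_const h p * \<epsilon>" using window_const_pos[OF h] eps by (simp add: less_imp_le)
  have Kq: "window_const h p * \<epsilon> \<le> q"
    using small KK mult_right_mono[of 1 "2 + p\<^sup>2" "window_const h p * \<epsilon>"] by (simp add: q_def mult.assoc)
  have decay: "integral {0..1} (\<lambda>y. (w y (6 * h * n))\<^sup>2 + (1 + p\<^sup>2) * (u y (6 * h * n))\<^sup>2) \<le> (q ^ n * N)\<^sup>2"
    for n :: nat
  proof (induction n)
    case 0 then show ?case using energy by simp
  next
    case (Suc n)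
    let ?t = "6 * h * real (Suc n)"
    define K where "K = window_const h p * \<epsilon> * (q ^ n * N)"
    have K: "K \<ge> 0" using KK q N by (simp add: K_def)
    have pw: "\<bar>u y ?t\<bar> \<le> K" "\<bar>w y ?t\<bar> \<le> K" if "y \<in> {0..1}" for y
      using window_bounds(1)[of "6 * h * real n" "q ^ n * N" y ?t]
        window_bounds(2)[of "6 * h * real n" "q ^ n * N" y ?t 0 0] Suc.IH that h q N
      by (auto simp: K_def algebra_simps)
    have t: "?t \<ge> 0" using h by simp
    have "integral {0..1} (\<lambda>y. (w y ?t)\<^sup>2 + (1 + p\<^sup>2) * (u y ?t)\<^sup>2)
        \<le> integral {0..1} (\<lambda>y :: real. (2 + p\<^sup>2) * K\<^sup>2)"
    proof (rule integral_le)
      show "(\<lambda>y. (w y ?t)\<^sup>2 + (1 + p\<^sup>2) * (u y ?t)\<^sup>2) integrable_on {0..1}"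
        by (intro integrable_continuous_real continuous_intros curve_continuity) (use t in auto)
      fix y :: real assume y: "y \<in> {0..1}"
      have "(w y ?t)\<^sup>2 \<le> K\<^sup>2" "(u y ?t)\<^sup>2 \<le> K\<^sup>2" using pw[OF y] K by (auto simp: abs_le_square_iff[symmetric])
      then have "(w y ?t)\<^sup>2 + (1 + p\<^sup>2) * (u y ?t)\<^sup>2 \<le> K\<^sup>2 + (1 + p\<^sup>2) * K\<^sup>2"
        by (intro add_mono mult_left_mono) auto
      then show "(w y ?t)\<^sup>2 + (1 + p\<^sup>2) * (u y ?t)\<^sup>2 \<le> (2 + p\<^sup>2) * K\<^sup>2" by (simp add: algebra_simps)
    qed (rule integrable_const_ivl)
    also have "\<dots> = (2 + p\<^sup>2) * K\<^sup>2" by simp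
    also have "\<dots> \<le> (2 + p\<^sup>2)\<^sup>2 * K\<^sup>2"
      using mult_right_mono[of 1 "2 + p\<^sup>2" "2 + p\<^sup>2"] by (intro mult_right_mono) (auto simp: power2_eq_square)
    also have "\<dots> = ((2 + p\<^sup>2) * window_const h p * \<epsilon> * (q ^ n * N))\<^sup>2"
      by (simp add: K_def power_mult_distrib mult_ac)
    also have "\<dots> \<le> (q * (q ^ n * N))\<^sup>2"
    proof (intro power_mono mult_right_mono)
      have "0 \<le> (2 + p\<^sup>2) * (window_const h p * \<epsilon>) * (q ^ n * N)"
        by (intro mult_nonneg_nonneg[OF mult_nonneg_nonneg[OF _ KK]]) (use q N in simp_all)
      then show "0 \<le> (2 + p\<^sup>2) * window_const h p * \<epsilon> * (q ^ n * N)"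
        by (simp only: mult.assoc)
    qed (use small q N in \<open>auto simp: q_def\<close>)
    finally show ?case by (simp add: mult.assoc)
  qed
  (* The window that contains t starts its waiting time at 6 h n. *)
  define n where "n = nat \<lfloor>t / (6 * h) - 1\<rfloor>"
  have "t / (6 * h) \<ge> 1" using t h by simp
  then have n: "real n \<le> t / (6 * h) - 1" "t / (6 * h) - 1 < real n + 1"
    unfolding n_def by (auto simp: of_nat_nat)
  then have t_lo: "6 * h * real n + 6 * h \<le> t" and t_hi: "t \<le> 6 * h * real n + 12 * h"
    using h by (auto simp: field_simps)
  have "\<bar>W \<alpha> \<beta> x t\<bar> \<le> window_const h p * \<epsilon> * (q ^ n * N)"
    by (rule window_bounds(2)[of "6 * h * real n"]) (use h q N decay[of n] x t_lo t_hi \<alpha>\<beta> in auto)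
  also have "\<dots> \<le> q * (q ^ n * N)" using Kq q N by (intro mult_right_mono) auto
  also have "\<dots> = exp (- \<gamma> * (6 * h * real n + 6 * h)) * N"
    by (simp add: q_def exp_of_nat_mult[symmetric] exp_add[symmetric] algebra_simps)
  also have "\<dots> \<le> exp (6 * h * \<gamma> - \<gamma> * t) * N"
  proof -
    have "\<gamma> * t \<le> \<gamma> * (6 * h * real n + 12 * h)" using t_hi \<gamma> by (intro mult_left_mono) auto
    then have "- \<gamma> * (6 * h * real n + 6 * h) \<le> 6 * h * \<gamma> - \<gamma> * t" by (simp add: algebra_simps)
    then show ?thesis using N by (intro mult_right_mono) auto
  qed
  also have "\<dots> = exp (6 * h * \<gamma>) * exp (- \<gamma> * t) * N" by (simp add: exp_add[symmetric])
  finally show ?thesis .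
qed

end

section \<open>The space \<open>L\<^sup>2(0,1)\<close>\<close>

lemma L2_norm_square: "(L2_norm f)\<^sup>2 = (LINT x|unit_lebesgue. (f x)\<^sup>2)"
  unfolding L2_norm_def by (simp add: integral_nonneg_AE)

lemma L2_norm_nonneg: "L2_norm f \<ge> 0"
  unfolding L2_norm_def by (simp add: integral_nonneg_AE)

lemma L2_continuous:
  assumes f: "continuous_on {0..1} f"
  shows "L2 f" "(L2_norm f)\<^sup>2 = integral {0..1} (\<lambda>x. (f x)\<^sup>2)"
proof -
  have "(\<lambda>x. (f x)\<^sup>2) absolutely_integrable_on {0..1}"
    by (intro absolutely_integrable_continuous_real continuous_intros f)
  then have "(\<lambda>x. (f x)\<^sup>2) absolutely_integrable_on {0<..<1}"
    by (rule set_integrable_subset) auto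
  then have I: "integrable unit_lebesgue (\<lambda>x. (f x)\<^sup>2)"
    by (simp add: set_integrable_def integrable_restrict_space)
  moreover have "f \<in> borel_measurable unit_lebesgue"
    by (intro continuous_imp_measurable_on_sets_lebesgue continuous_on_subset[OF f]) auto
  ultimately show "L2 f" by (simp add: L2_def)
  show "(L2_norm f)\<^sup>2 = integral {0..1} (\<lambda>x. (f x)\<^sup>2)"
    unfolding L2_norm_square using lebesgue_integral_eq_integral[OF I]
    by (simp add: integral_open_interval_real)
qed

lemma L2_cmult:
  assumes "L2 f"
  shows "L2 (\<lambda>x. r * f x)" "(L2_norm (\<lambda>x. r * f x))\<^sup>2 = r\<^sup>2 * (L2_norm f)\<^sup>2"
  using assms by (auto simp: L2_def L2_norm_square power_mult_distrib)

text \<open>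
  The factor \<open>2\<close> replaces Minkowski's inequality; it only affects the final constant.
\<close>

lemma L2_add:
  assumes f: "L2 f" and g: "L2 g"
  shows "L2 (\<lambda>x. f x + g x)"
    "(L2_norm (\<lambda>x. f x + g x))\<^sup>2 \<le> 2 * (L2_norm f)\<^sup>2 + 2 * (L2_norm g)\<^sup>2"
proof -
  have le: "(f x + g x)\<^sup>2 \<le> 2 * (f x)\<^sup>2 + 2 * (g x)\<^sup>2" for x
    using zero_le_power2[of "f x - g x"] by (simp add: power2_sum power2_diff)
  have I: "integrable unit_lebesgue (\<lambda>x. 2 * (f x)\<^sup>2 + 2 * (g x)\<^sup>2)"
    using f g by (auto simp: L2_def)
  have m: "(\<lambda>x. f x + g x) \<in> borel_measurable unit_lebesgue" using f g by (auto simp: L2_def)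
  have J: "integrable unit_lebesgue (\<lambda>x. (f x + g x)\<^sup>2)"
    by (rule Bochner_Integration.integrable_bound[OF I]) (use m le in \<open>auto simp: abs_of_nonneg\<close>)
  with m show "L2 (\<lambda>x. f x + g x)" by (simp add: L2_def)
  have "(LINT x|unit_lebesgue. (f x + g x)\<^sup>2) \<le> (LINT x|unit_lebesgue. 2 * (f x)\<^sup>2 + 2 * (g x)\<^sup>2)"
    by (rule integral_mono[OF J I le])
  also have "\<dots> = 2 * (LINT x|unit_lebesgue. (f x)\<^sup>2) + 2 * (LINT x|unit_lebesgue. (g x)\<^sup>2)"
    using f g by (subst Bochner_Integration.integral_add) (auto simp: L2_def)
  finally show "(L2_norm (\<lambda>x. f x + g x))\<^sup>2 \<le> 2 * (L2_norm f)\<^sup>2 + 2 * (L2_norm g)\<^sup>2"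
    by (simp add: L2_norm_square)
qed

lemma L2_diff:
  assumes f: "L2 f" and g: "L2 g"
  shows "L2 (\<lambda>x. f x - g x)"
    "(L2_norm (\<lambda>x. f x - g x))\<^sup>2 \<le> 2 * (L2_norm f)\<^sup>2 + 2 * (L2_norm g)\<^sup>2"
  using L2_add[OF f L2_cmult(1)[OF g, of "-1"]] L2_cmult(2)[OF g, of "-1"] by simp_all

lemma L2_norm_eq_0:
  assumes "L2 f" "L2_norm f = 0"
  shows "AE x in unit_lebesgue. f x = 0"
proof -
  have "(LINT x|unit_lebesgue. (f x)\<^sup>2) = 0" using assms(2) L2_norm_square[of f] by simp
  then have "AE x in unit_lebesgue. (f x)\<^sup>2 = 0"
    using assms(1) by (subst (asm) integral_nonneg_eq_0_iff_AE) (auto simp: L2_def)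
  then show ?thesis by simp
qed

text \<open>
  On an interval of length one the uniform distance dominates the \<open>L\<^sup>2\<close> distance, so both limits are
  \<open>L\<^sup>2\<close> limits of the same sequence.
\<close>

lemma L2_limit_eq_uniform_limit:
  assumes f: "L2 f" and g: "\<And>l::nat. continuous_on {0..1} (g l)" "continuous_on {0..1} g'"
    and L2: "(\<lambda>l. L2_norm (\<lambda>x. f x - g l x)) \<longlonglongrightarrow> 0"
    and unif: "uniform_limit {0..1} g g' sequentially"
  shows "AE x in unit_lebesgue. f x = g' x"
proof -
  have L2': "(\<lambda>l. (L2_norm (\<lambda>x. f x - g l x))\<^sup>2) \<longlonglongrightarrow> 0"
    using tendsto_power[OF L2, where n = 2] by simp
  have "(L2_norm (\<lambda>x. f x - g' x))\<^sup>2 \<le> \<eta>" if "\<eta> > 0" for \<eta>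
  proof -
    define \<delta> where "\<delta> = sqrt (\<eta> / 4)"
    have \<delta>: "\<delta> > 0" "\<delta>\<^sup>2 = \<eta> / 4" using that by (auto simp: \<delta>_def)
    have "\<forall>\<^sub>F l in sequentially. \<forall>x\<in>{0..1}. dist (g l x) (g' x) < \<delta>"
      using unif \<delta> by (auto simp: uniform_limit_iff)
    moreover have "\<forall>\<^sub>F l in sequentially. (L2_norm (\<lambda>x. f x - g l x))\<^sup>2 < \<eta> / 4"
      using L2' by (rule order_tendstoD) (use that in simp)
    ultimately have "\<forall>\<^sub>F l in sequentially. (L2_norm (\<lambda>x. f x - g' x))\<^sup>2 \<le> \<eta>"
    proof eventually_elim
      case (elim l)
      have cont: "continuous_on {0..1} (\<lambda>x. g l x - g' x)" by (intro continuous_intros g)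
      have "(L2_norm (\<lambda>x. g l x - g' x))\<^sup>2 \<le> integral {0..1} (\<lambda>x::real. \<eta> / 4)"
        unfolding L2_continuous(2)[OF cont]
      proof (rule integral_le)
        show "(\<lambda>x. (g l x - g' x)\<^sup>2) integrable_on {0..1}"
          by (intro integrable_continuous_real continuous_intros g)
        show "(g l x - g' x)\<^sup>2 \<le> \<eta> / 4" if "x \<in> {0..1}" for x
          using elim(1) that \<delta> unfolding \<delta>(2)[symmetric]
          by (force simp: dist_real_def abs_le_square_iff[symmetric])
      qed (rule integrable_const_ivl)
      moreover have "(L2_norm (\<lambda>x. (f x - g l x) + (g l x - g' x)))\<^sup>2
          \<le> 2 * (L2_norm (\<lambda>x. f x - g l x))\<^sup>2 + 2 * (L2_norm (\<lambda>x. g l x - g' x))\<^sup>2"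
        by (intro L2_add(2) L2_diff(1) f L2_continuous(1) g)
      ultimately show ?case using elim(2) by simp
    qed
    then show ?thesis by (auto simp: eventually_sequentially)
  qed
  then have "(L2_norm (\<lambda>x. f x - g' x))\<^sup>2 \<le> 0" by (rule field_le_epsilon[of _ 0, simplified])
  then have "L2_norm (\<lambda>x. f x - g' x) = 0" by simp
  then have "AE x in unit_lebesgue. f x - g' x = 0"
    by (intro L2_norm_eq_0 L2_diff(1) f L2_continuous(1) g)
  then show ?thesis by simp
qed

lemma (in wave_system) exponential_decay_L2:
  assumes \<phi>: "continuous_on {0..1} \<phi>\<^sub>1" "continuous_on {0..1} \<phi>\<^sub>2"
    and init: "\<And>y. y \<in> {0..1} \<Longrightarrow> w y 0 = \<phi>\<^sub>1 y \<and> u y 0 = \<phi>\<^sub>2 y"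
    and energy: "(L2_norm \<phi>\<^sub>1)\<^sup>2 + (1 + p\<^sup>2) * (L2_norm \<phi>\<^sub>2)\<^sup>2 \<le> N\<^sup>2"
    and N: "N > 0" and small: "(2 + p\<^sup>2) * window_const h p * \<epsilon> \<le> exp (- \<gamma> * (6 * h))"
    and \<gamma>: "\<gamma> > 0" and x: "x \<in> {0..1}" and t: "t \<ge> 6 * h" and \<alpha>\<beta>: "\<alpha> + \<beta> \<le> 2"
  shows "\<bar>W \<alpha> \<beta> x t\<bar> \<le> exp (6 * h * \<gamma>) * exp (- \<gamma> * t) * N"
proof (rule exponential_decay[OF N small _ \<gamma> x t \<alpha>\<beta>])
  have "integral {0..1} (\<lambda>y. (w y 0)\<^sup>2 + (1 + p\<^sup>2) * (u y 0)\<^sup>2)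
      = integral {0..1} (\<lambda>y. (\<phi>\<^sub>1 y)\<^sup>2 + (1 + p\<^sup>2) * (\<phi>\<^sub>2 y)\<^sup>2)"
    by (intro integral_cong) (simp add: init)
  also have "\<dots> = (L2_norm \<phi>\<^sub>1)\<^sup>2 + (1 + p\<^sup>2) * (L2_norm \<phi>\<^sub>2)\<^sup>2"
    by (subst integral_add) (auto simp: L2_continuous[OF \<phi>(1)] L2_continuous[OF \<phi>(2)]
          intro!: integrable_continuous_real continuous_intros \<phi>)
  finally show "integral {0..1} (\<lambda>y. (w y 0)\<^sup>2 + (1 + p\<^sup>2) * (u y 0)\<^sup>2) \<le> N\<^sup>2"
    using energy by simp
qed

section \<open>Classical solutions\<close>

lemma vanishes_on_closed_strip:
  fixes f :: "real \<Rightarrow> real \<Rightarrow> real"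
  assumes f: "continuous_on ({0..1} \<times> {0..}) (\<lambda>(x, t). f x t)"
    and 0: "\<And>x t. x \<in> {0<..<1} \<Longrightarrow> t > 0 \<Longrightarrow> f x t = 0"
    and "x \<in> {0..1}" "t \<ge> 0"
  shows "f x t = 0"
proof -
  have cl: "closure ({0<..<1} \<times> {0<..}) = {0..1::real} \<times> {0::real..}"
    by (simp add: closure_Times)
  have "(\<lambda>(x, t). f x t) (x, t) = 0"
    by (rule continuous_constant_on_closure[of "{0<..<1} \<times> {0<..}"]) (use f 0 assms(3,4) in \<open>auto simp: cl\<close>)
  then show ?thesis by simp
qed

lemma vanishes_on_closed_halfline:
  fixes f :: "real \<Rightarrow> real"
  assumes f: "continuous_on {0..} f" and 0: "\<And>t. t > 0 \<Longrightarrow> f t = 0" and "t \<ge> 0"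
  shows "f t = 0"
  by (rule continuous_constant_on_closure[of "{0<..}"]) (use assms in auto)

text \<open>
  The norms on \<open>[0,1] \<times> [0,S]\<close> are formed with derivatives within \<open>[0,S]\<close>.  These agree with the
  derivatives within \<open>[0,\<infinity>)\<close>, also one-sidedly at \<open>t = S\<close>.  Boundedness of the derivatives makes the suprema
  genuine ones.
\<close>

lemma C2_norm_bound:
  assumes c: "C2_bounded_on {0..1} {0..} c"
    and norm: "(SUP S\<in>{0<..}. C2_norm {0..1} {0..S} c) < \<epsilon>"
    and "\<alpha> + \<beta> \<le> 2" "x \<in> {0..1}" "t \<ge> 0"
  shows "\<bar>partial {0..1} {0..} \<alpha> \<beta> c x t\<bar> \<le> \<epsilon>"
proof -
  let ?P = "\<lambda>\<alpha> \<beta>. partial {0..1} {0..} \<alpha> \<beta> c"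
  have fam: "C2_family {0..1} {0..} ?P"
    using c by (intro C2_family_partial) (simp add: C2_bounded_on_def)
  have eq: "partial {0..1} {0..S} \<alpha> \<beta> c x t = ?P \<alpha> \<beta> x t"
    if "S > 0" "\<alpha> + \<beta> \<le> 2" "x \<in> {0..1}" "t \<in> {0..S}" for S \<alpha> \<beta> x t
    by (rule partial_eq_C2_family[OF C2_family_subset[OF fam]])
       (use that at_within_nonbot in \<open>auto simp: partial_def\<close>)
  let ?I = "{(\<alpha>::nat, \<beta>::nat). \<alpha> + \<beta> \<le> 2}"
  have "finite ?I" by (rule finite_subset[of _ "{..2} \<times> {..2}"]) auto
  then have "bounded (\<Union>(\<alpha>, \<beta>)\<in>?I. (\<lambda>(x, t). ?P \<alpha> \<beta> x t) ` ({0..1} \<times> {0..}))"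
    using c by (intro bounded_UN) (auto simp: C2_bounded_on_def)
  then obtain B where B: "\<And>\<alpha> \<beta> x t. \<alpha> + \<beta> \<le> 2 \<Longrightarrow> x \<in> {0..1} \<Longrightarrow> t \<ge> 0 \<Longrightarrow> \<bar>?P \<alpha> \<beta> x t\<bar> \<le> B"
    unfolding bounded_iff by fastforce
  define A where "A S = {\<bar>partial {0..1} {0..S} \<alpha> \<beta> c x t\<bar> |\<alpha> \<beta> x t. \<alpha> + \<beta> \<le> 2 \<and> x \<in> {0..1} \<and> t \<in> {0..S}}"
    for S
  have A: "z \<le> B" if "z \<in> A S" "S > 0" for z S
  proof -
    obtain \<alpha> \<beta> x t where z: "z = \<bar>partial {0..1} {0..S} \<alpha> \<beta> c x t\<bar>"
      "\<alpha> + \<beta> \<le> 2" "x \<in> {0..1}" "t \<in> {0..S}" using \<open>z \<in> A S\<close> unfolding A_def by blast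
    then show ?thesis using eq[OF \<open>S > 0\<close> z(2-4)] B[of \<alpha> \<beta> x t] by simp
  qed
  have norm_A: "C2_norm {0..1} {0..S} c = Sup (A S)" for S by (simp add: C2_norm_def A_def)
  have Sup_le: "Sup (A S) \<le> B" if "S > 0" for S
  proof (rule cSup_least)
    have "\<bar>partial {0..1} {0..S} 0 0 c 0 0\<bar> \<in> A S" unfolding A_def using that by force
    then show "A S \<noteq> {}" by blast
  qed (use A that in blast)
  (* The norms are only formed for S > 0, so S = t would fail at t = 0. *)
  define S where "S = max 1 t"
  have S: "S > 0" "t \<in> {0..S}" using assms(5) by (auto simp: S_def)
  have "\<bar>partial {0..1} {0..S} \<alpha> \<beta> c x t\<bar> \<in> A S" unfolding A_def using assms(3,4) S by blast
  then have "\<bar>?P \<alpha> \<beta> x t\<bar> \<in> A S" using eq[OF S(1) assms(3,4) S(2)] by simp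
  then have "\<bar>?P \<alpha> \<beta> x t\<bar> \<le> Sup (A S)"
    by (rule cSup_upper) (use A S in \<open>auto intro!: bdd_aboveI[of _ B]\<close>)
  also have "\<dots> \<le> (SUP S\<in>{0<..}. Sup (A S))"
    by (rule cSUP_upper) (use S Sup_le in \<open>auto intro!: bdd_aboveI2[of _ _ B]\<close>)
  also have "\<dots> < \<epsilon>" using norm by (simp add: norm_A)
  finally show ?thesis by simp
qed

text \<open>
  The equations extend from the open strip to its closure, and the boundary conditions to \<open>t = 0\<close>, by
  continuity of the derivatives.
\<close>

lemma wave_system_classical:
  assumes a: "a > 0" and eps: "0 \<le> \<epsilon>" "\<epsilon> \<le> 1"
    and c: "C2_on {0..1} {0..} c"
    and c_bound: "\<And>\<alpha> \<beta> x t. \<alpha> + \<beta> \<le> 2 \<Longrightarrow> x \<in> {0..1} \<Longrightarrow> t \<ge> 0 \<Longrightarrow>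
      \<bar>partial {0..1} {0..} \<alpha> \<beta> c x t\<bar> \<le> \<epsilon>"
    and sol: "classical_solution a p c \<phi>\<^sub>1 \<phi>\<^sub>2 w u"
  shows "wave_system (1 / a) p \<epsilon> (\<lambda>\<alpha> \<beta>. partial {0..1} {0..} \<alpha> \<beta> c)
    (\<lambda>\<alpha> \<beta>. partial {0..1} {0..} \<alpha> \<beta> w) (\<lambda>\<alpha> \<beta>. partial {0..1} {0..} \<alpha> \<beta> u)"
proof -
  let ?P = "\<lambda>f \<alpha> \<beta>. partial {0..1} {0..} \<alpha> \<beta> f"
  have C: "C2_family {0..1} {0..} (?P c)" and W: "C2_family {0..1} {0..} (?P w)"
    and U: "C2_family {0..1} {0..} (?P u)"
    using c sol by (auto simp: classical_solution_def intro: C2_family_partial)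
  have [simp]: "?P f 0 0 = f" for f by (simp add: partial_def)
  have cont: "continuous_on ({0..1} \<times> {0..}) (\<lambda>z. ?P c \<alpha> \<beta> (fst z) (snd z))"
    "continuous_on ({0..1} \<times> {0..}) (\<lambda>z. ?P w \<alpha> \<beta> (fst z) (snd z))"
    "continuous_on ({0..1} \<times> {0..}) (\<lambda>z. ?P u \<alpha> \<beta> (fst z) (snd z))" if "\<alpha> + \<beta> \<le> 2" for \<alpha> \<beta>
    using C2_family_continuous[OF C that] C2_family_continuous[OF W that]
      C2_family_continuous[OF U that] by (simp_all add: case_prod_beta')
  note cont0 = cont[of 0 0, simplified]
  have w_eq: "?P w 0 (Suc 0) x t + a * ?P w (Suc 0) 0 x t - u x t = 0" if "x \<in> {0..1}" "t \<ge> 0" for x t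
  proof (rule vanishes_on_closed_strip[OF _ _ that])
    show "continuous_on ({0..1} \<times> {0..}) (\<lambda>(x, t). ?P w 0 (Suc 0) x t + a * ?P w (Suc 0) 0 x t - u x t)"
      unfolding case_prod_beta' by (intro continuous_intros cont cont0) auto
  qed (use sol in \<open>auto simp: classical_solution_def partial_def\<close>)
  have u_eq: "?P u 0 (Suc 0) x t - a * ?P u (Suc 0) 0 x t + c x t * w x t = 0" if "x \<in> {0..1}" "t \<ge> 0" for x t
  proof (rule vanishes_on_closed_strip[OF _ _ that])
    show "continuous_on ({0..1} \<times> {0..})
        (\<lambda>(x, t). ?P u 0 (Suc 0) x t - a * ?P u (Suc 0) 0 x t + c x t * w x t)"
      unfolding case_prod_beta' by (intro continuous_intros cont cont0) auto
  qed (use sol in \<open>auto simp: classical_solution_def partial_def\<close>)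
  have slice: "continuous_on {0..} (w x)" "continuous_on {0..} (u x)" if "x \<in> {0..1}" for x
    using continuous_on_slice(1)[OF C2_family_continuous[OF W, of 0 0] that]
      continuous_on_slice(1)[OF C2_family_continuous[OF U, of 0 0] that] by simp_all
  have left: "w 0 t - p * u 0 t = 0" and right: "u 1 t = 0" if "t \<ge> 0" for t
    by (rule vanishes_on_closed_halfline[OF _ _ that];
        use sol slice in \<open>auto simp: classical_solution_def intro!: continuous_intros\<close>)+
  show ?thesis
  proof
    show "?P w (Suc 0) 0 x t = 1 / a * (?P u 0 0 x t - ?P w 0 (Suc 0) x t)"
      if "x \<in> {0..1}" "t \<ge> 0" for x t
      using w_eq[OF that] a by (simp add: field_simps)
    show "?P u (Suc 0) 0 x t = 1 / a * (?P u 0 (Suc 0) x t + ?P c 0 0 x t * ?P w 0 0 x t)"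
      if "x \<in> {0..1}" "t \<ge> 0" for x t
      using u_eq[OF that] a by (simp add: field_simps)
  qed (use a eps C W U c_bound left right in auto)
qed

lemma wave_system_diff:
  assumes "wave_system h p \<epsilon> C W U" "wave_system h p \<epsilon> C W' U'"
  shows "wave_system h p \<epsilon> C (\<lambda>\<alpha> \<beta> x t. W \<alpha> \<beta> x t - W' \<alpha> \<beta> x t) (\<lambda>\<alpha> \<beta> x t. U \<alpha> \<beta> x t - U' \<alpha> \<beta> x t)"
proof -
  interpret A: wave_system h p \<epsilon> C W U by fact
  interpret B: wave_system h p \<epsilon> C W' U' by fact
  show ?thesis
    by unfold_locales
       (use A.h A.eps A.C A.C_bound in \<open>auto intro: C2_family_diff A.W A.U B.W B.U
          simp: A.w_x B.w_x A.u_x B.u_x A.w_left B.w_left A.u_right B.u_right algebra_simps\<close>)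
qed

section \<open>Decay of \<open>L\<^sup>2\<close>-generalized solutions\<close>

theorem corollary1p4:
  fixes a p :: real
  assumes "a > 0"
  shows "\<forall>\<gamma>>0. \<exists>\<epsilon>>0. \<exists>M\<^sub>2\<ge>stability_constant a p \<gamma>.
    \<forall>c. C2_bounded_on {0..1} {0..} c \<longrightarrow>
      (SUP S\<in>{0<..}. C2_norm {0..1} {0..S} c) < \<epsilon> \<longrightarrow>
      (\<forall>w\<^sub>0 w\<^sub>1 w. H1 w\<^sub>0 \<longrightarrow> L2 w\<^sub>1 \<longrightarrow> L2_generalized_solution a p c w\<^sub>0 w\<^sub>1 w \<longrightarrow>
        (\<exists>W. (\<forall>t>6/a. AE x in unit_lebesgue. w x t = W x t) \<and>
             C2_on {0..1} {6/a<..} W \<and>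
             (\<forall>\<alpha> \<beta>. \<alpha> + \<beta> \<le> 2 \<longrightarrow>
               (\<forall>t>6/a. sup_norm {0..1} (\<lambda>x. partial {0..1} {6/a<..} \<alpha> \<beta> W x t)
                   \<le> M\<^sub>2 * exp (- \<gamma> * t) * max (H1_norm w\<^sub>0) (L2_norm w\<^sub>1)))))"
proof (intro allI impI)
  fix \<gamma> :: real assume \<gamma>: "\<gamma> > 0"
  define k where "k = 1 + p\<^sup>2"
  have k: "k > 0" by (auto simp: k_def intro: add_pos_nonneg)
  define K where "K = (2 + p\<^sup>2) * window_const (1 / a) p"
  have K: "K > 0" using window_const_pos[of "1 / a" p] assms by (auto simp: K_def intro!: mult_pos_pos add_pos_nonneg)
  define \<epsilon> where "\<epsilon> = min 1 (exp (- \<gamma> * (6 * (1 / a))) / K)"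
  have eps: "\<epsilon> > 0" "\<epsilon> \<le> 1" "K * \<epsilon> \<le> exp (- \<gamma> * (6 * (1 / a)))"
    using K by (auto simp: \<epsilon>_def min_def field_simps)
  define G where "G = exp (6 * (1 / a) * \<gamma>)"
  (* With m the maximum of the norms of the data, (\<kappa> m)^2 bounds twice the energy of the data
     w_0, w_1 + a w_0'. *)
  define \<kappa> where "\<kappa> = sqrt (2 + 2 * k * (2 + 2 * a\<^sup>2))"
  have \<kappa>: "\<kappa> \<ge> 0" "\<kappa>\<^sup>2 = 2 + 2 * k * (2 + 2 * a\<^sup>2)" using k by (auto simp: \<kappa>_def)
  define M\<^sub>2 where "M\<^sub>2 = max (stability_constant a p \<gamma>) (G * \<kappa>)"
  show "\<exists>\<epsilon>>0. \<exists>M\<^sub>2\<ge>stability_constant a p \<gamma>.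
    \<forall>c. C2_bounded_on {0..1} {0..} c \<longrightarrow>
      (SUP S\<in>{0<..}. C2_norm {0..1} {0..S} c) < \<epsilon> \<longrightarrow>
      (\<forall>w\<^sub>0 w\<^sub>1 w. H1 w\<^sub>0 \<longrightarrow> L2 w\<^sub>1 \<longrightarrow> L2_generalized_solution a p c w\<^sub>0 w\<^sub>1 w \<longrightarrow>
        (\<exists>W. (\<forall>t>6/a. AE x in unit_lebesgue. w x t = W x t) \<and>
             C2_on {0..1} {6/a<..} W \<and>
             (\<forall>\<alpha> \<beta>. \<alpha> + \<beta> \<le> 2 \<longrightarrow>
               (\<forall>t>6/a. sup_norm {0..1} (\<lambda>x. partial {0..1} {6/a<..} \<alpha> \<beta> W x t)
                   \<le> M\<^sub>2 * exp (- \<gamma> * t) * max (H1_norm w\<^sub>0) (L2_norm w\<^sub>1)))))"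
  proof (rule exI[of _ \<epsilon>], intro conjI, fact, rule exI[of _ M\<^sub>2], intro conjI allI impI)
    show "stability_constant a p \<gamma> \<le> M\<^sub>2" by (simp add: M\<^sub>2_def)
    fix c w\<^sub>0 w\<^sub>1 w
    assume c: "C2_bounded_on {0..1} {0..} c" "(SUP S\<in>{0<..}. C2_norm {0..1} {0..S} c) < \<epsilon>"
      and w\<^sub>0: "H1 w\<^sub>0" and w\<^sub>1: "L2 w\<^sub>1" and w: "L2_generalized_solution a p c w\<^sub>0 w\<^sub>1 w"
    define v\<^sub>0 where "v\<^sub>0 x = w\<^sub>1 x + a * weak_derivative w\<^sub>0 x" for x
    define m where "m = max (H1_norm w\<^sub>0) (L2_norm w\<^sub>1)"
    obtain u \<phi>\<^sub>1 \<phi>\<^sub>2 wl ul where cw: "continuous_into_L2 w"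
      and test: "\<And>l::nat. test_function (\<phi>\<^sub>1 l) \<and> test_function (\<phi>\<^sub>2 l)"
      and sol: "\<And>l. classical_solution a p c (\<phi>\<^sub>1 l) (\<phi>\<^sub>2 l) (wl l) (ul l)"
      and \<phi>\<^sub>1: "(\<lambda>l. L2_norm (\<lambda>x. \<phi>\<^sub>1 l x - w\<^sub>0 x)) \<longlonglongrightarrow> 0"
      and \<phi>\<^sub>2: "(\<lambda>l. L2_norm (\<lambda>x. \<phi>\<^sub>2 l x - v\<^sub>0 x)) \<longlonglongrightarrow> 0"
      and wl: "\<And>t. t > 0 \<Longrightarrow>
        uniform_limit {0..t} (\<lambda>l \<theta>. L2_norm (\<lambda>x. w x \<theta> - wl l x \<theta>)) (\<lambda>\<theta>. 0) sequentially"
      using w unfolding L2_generalized_solution_def v\<^sub>0_def by blast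
    define D where "D l \<alpha> \<beta> = partial {0..1} {0..} \<alpha> \<beta> (wl l)" for l \<alpha> \<beta>
    define U where "U l \<alpha> \<beta> = partial {0..1} {0..} \<alpha> \<beta> (ul l)" for l \<alpha> \<beta>
    define C where "C \<alpha> \<beta> = partial {0..1} {0..} \<alpha> \<beta> c" for \<alpha> \<beta>
    have sys: "wave_system (1 / a) p \<epsilon> C (D l) (U l)" for l
      unfolding C_def[abs_def] D_def[abs_def] U_def[abs_def]
      by (rule wave_system_classical[OF assms _ _ _ C2_norm_bound[OF c] sol])
         (use eps c in \<open>auto simp: C2_bounded_on_def\<close>)
    have init: "D l 0 0 x 0 = \<phi>\<^sub>1 l x" "U l 0 0 x 0 = \<phi>\<^sub>2 l x" if "x \<in> {0..1}" for l x
      using sol[of l] that by (auto simp: classical_solution_def D_def U_def partial_def)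
    have small: "(2 + p\<^sup>2) * window_const (1 / a) p * \<epsilon> \<le> exp (- \<gamma> * (6 * (1 / a)))"
      using eps by (simp add: K_def)
    have cont: "continuous_on {0..1} (\<phi>\<^sub>1 l)" "continuous_on {0..1} (\<phi>\<^sub>2 l)" for l
    proof -
      have "\<phi> differentiable at x" if "test_function \<phi>" for \<phi> x
        using that unfolding test_function_def by (metis funpow_0)
      then show "continuous_on {0..1} (\<phi>\<^sub>1 l)" "continuous_on {0..1} (\<phi>\<^sub>2 l)"
        using test[of l] by (auto intro!: continuous_at_imp_continuous_on differentiable_imp_continuous_within)
    qed
    define e where "e l = (L2_norm (\<lambda>x. \<phi>\<^sub>1 l x - w\<^sub>0 x))\<^sup>2 + k * (L2_norm (\<lambda>x. \<phi>\<^sub>2 l x - v\<^sub>0 x))\<^sup>2" for l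
    have e: "e \<longlonglongrightarrow> 0"
      unfolding e_def[abs_def] by (rule tendsto_eq_intros \<phi>\<^sub>1 \<phi>\<^sub>2 refl)+ simp
    define E\<^sub>0 where "E\<^sub>0 = (L2_norm w\<^sub>0)\<^sup>2 + k * (L2_norm v\<^sub>0)\<^sup>2"
    have L2w: "L2 w\<^sub>0" using w\<^sub>0 by (simp add: H1_def)
    have L2w': "L2 (weak_derivative w\<^sub>0)"
      using w\<^sub>0 unfolding H1_def weak_derivative_def by (metis (mono_tags, lifting) someI_ex)
    have L2v: "L2 v\<^sub>0" unfolding v\<^sub>0_def[abs_def] by (intro L2_add L2_cmult w\<^sub>1 L2w')
    note L2\<phi> = L2_continuous(1)[OF cont(1)] L2_continuous(1)[OF cont(2)]
    have combine: "x\<^sub>1 + k * x\<^sub>2 \<le> 2 * (y\<^sub>1 + k * y\<^sub>2) + 2 * (z\<^sub>1 + k * z\<^sub>2)"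
      if "x\<^sub>1 \<le> 2 * y\<^sub>1 + 2 * z\<^sub>1" "x\<^sub>2 \<le> 2 * y\<^sub>2 + 2 * z\<^sub>2" for x\<^sub>1 x\<^sub>2 y\<^sub>1 y\<^sub>2 z\<^sub>1 z\<^sub>2 :: real
      using that(1) mult_left_mono[OF that(2), of k] k by (simp add: algebra_simps)
    have energy_diff: "(L2_norm (\<lambda>x. \<phi>\<^sub>1 i x - \<phi>\<^sub>1 j x))\<^sup>2 + k * (L2_norm (\<lambda>x. \<phi>\<^sub>2 i x - \<phi>\<^sub>2 j x))\<^sup>2
        \<le> 2 * e i + 2 * e j" for i j
      unfolding e_def
      using L2_diff(2)[OF L2_diff(1)[OF L2\<phi>(1) L2w] L2_diff(1)[OF L2\<phi>(1) L2w], of i j]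
        L2_diff(2)[OF L2_diff(1)[OF L2\<phi>(2) L2v] L2_diff(1)[OF L2\<phi>(2) L2v], of i j]
      by (intro combine) simp_all
    have energy_single: "(L2_norm (\<phi>\<^sub>1 i))\<^sup>2 + k * (L2_norm (\<phi>\<^sub>2 i))\<^sup>2 \<le> 2 * e i + 2 * E\<^sub>0" for i
      unfolding e_def E\<^sub>0_def
      using L2_add(2)[OF L2_diff(1)[OF L2\<phi>(1) L2w] L2w, of i] L2_add(2)[OF L2_diff(1)[OF L2\<phi>(2) L2v] L2v, of i]
      by (intro combine) simp_all
    have m: "m \<ge> 0" "(L2_norm w\<^sub>0)\<^sup>2 \<le> m\<^sup>2" "(L2_norm (weak_derivative w\<^sub>0))\<^sup>2 \<le> m\<^sup>2" "(L2_norm w\<^sub>1)\<^sup>2 \<le> m\<^sup>2"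
    proof -
      have "H1_norm w\<^sub>0 \<ge> 0" "(H1_norm w\<^sub>0)\<^sup>2 = (L2_norm w\<^sub>0)\<^sup>2 + (L2_norm (weak_derivative w\<^sub>0))\<^sup>2"
        by (auto simp: H1_norm_def)
      moreover show "m \<ge> 0" using L2_norm_nonneg[of w\<^sub>1] by (simp add: m_def)
      moreover have "(H1_norm w\<^sub>0)\<^sup>2 \<le> m\<^sup>2"
        using \<open>H1_norm w\<^sub>0 \<ge> 0\<close> by (intro power_mono) (auto simp: m_def)
      ultimately show "(L2_norm w\<^sub>0)\<^sup>2 \<le> m\<^sup>2" "(L2_norm (weak_derivative w\<^sub>0))\<^sup>2 \<le> m\<^sup>2"
        using zero_le_power2[of "L2_norm w\<^sub>0"] zero_le_power2[of "L2_norm (weak_derivative w\<^sub>0)"] by linarith+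
      show "(L2_norm w\<^sub>1)\<^sup>2 \<le> m\<^sup>2"
        by (intro power_mono L2_norm_nonneg) (auto simp: m_def)
    qed
    have E\<^sub>0: "2 * E\<^sub>0 \<le> (\<kappa> * m)\<^sup>2"
    proof -
      have "(L2_norm v\<^sub>0)\<^sup>2 \<le> 2 * (L2_norm w\<^sub>1)\<^sup>2 + 2 * (a\<^sup>2 * (L2_norm (weak_derivative w\<^sub>0))\<^sup>2)"
        using L2_add(2)[OF w\<^sub>1 L2_cmult(1)[OF L2w'], of a] L2_cmult(2)[OF L2w', of a]
        by (simp add: v\<^sub>0_def[abs_def])
      also have "\<dots> \<le> 2 * m\<^sup>2 + 2 * (a\<^sup>2 * m\<^sup>2)" using m by (intro add_mono mult_left_mono) auto
      finally have "E\<^sub>0 \<le> m\<^sup>2 + k * (2 * m\<^sup>2 + 2 * (a\<^sup>2 * m\<^sup>2))"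
        unfolding E\<^sub>0_def using m k by (intro add_mono mult_left_mono) auto
      then show ?thesis by (simp add: power_mult_distrib \<kappa> algebra_simps)
    qed
    have est_diff: "\<bar>D i \<alpha> \<beta> x t - D j \<alpha> \<beta> x t\<bar> \<le> G * exp (- \<gamma> * t) * N"
      if "N > 0" "2 * e i + 2 * e j \<le> N\<^sup>2" "x \<in> {0..1}" "t \<ge> 6 / a" "\<alpha> + \<beta> \<le> 2" for i j \<alpha> \<beta> x t N
    proof -
      interpret wave_system "1 / a" p \<epsilon> C "\<lambda>\<alpha> \<beta> x t. D i \<alpha> \<beta> x t - D j \<alpha> \<beta> x t"
          "\<lambda>\<alpha> \<beta> x t. U i \<alpha> \<beta> x t - U j \<alpha> \<beta> x t"
        by (rule wave_system_diff[OF sys sys])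
      show ?thesis unfolding G_def
      proof (rule exponential_decay_L2)
        show "continuous_on {0..1} (\<lambda>x. \<phi>\<^sub>1 i x - \<phi>\<^sub>1 j x)" "continuous_on {0..1} (\<lambda>x. \<phi>\<^sub>2 i x - \<phi>\<^sub>2 j x)"
          by (intro continuous_intros cont)+
      qed (use that init energy_diff[of i j] small \<gamma> in \<open>auto simp: k_def\<close>)
    qed
    have est: "\<bar>D i \<alpha> \<beta> x t\<bar> \<le> G * exp (- \<gamma> * t) * N"
      if "N > 0" "2 * e i + 2 * E\<^sub>0 \<le> N\<^sup>2" "x \<in> {0..1}" "t \<ge> 6 / a" "\<alpha> + \<beta> \<le> 2" for i \<alpha> \<beta> x t N
    proof -
      interpret wave_system "1 / a" p \<epsilon> C "D i" "U i" by (rule sys)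
      show ?thesis unfolding G_def
        by (rule exponential_decay_L2[OF cont])
           (use that init energy_single[of i] small \<gamma> in \<open>auto simp: k_def\<close>)
    qed
    have G: "G > 0" by (simp add: G_def)
    have decr: "exp (- \<gamma> * t) \<le> 1" if "t > 6 / a" for t
    proof -
      have "6 / a > 0" using assms by simp
      with that have "t > 0" by linarith
      then show ?thesis using \<gamma> by simp
    qed
    have Cauchy: "uniformly_Cauchy_on ({0..1} \<times> {6/a<..}) (\<lambda>l (x, t). D l \<alpha> \<beta> x t)"
      if "\<alpha> + \<beta> \<le> 2" for \<alpha> \<beta>
      unfolding uniformly_Cauchy_on_def
    proof (intro allI impI)
      fix \<eta> :: real assume "\<eta> > 0"
      (* Any N with G N < \<eta> would do; it plays the role of the norm of the difference of the data. *)
      define N where "N = \<eta> / (2 * G)"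
      have N: "N > 0" "G * N < \<eta>" using \<open>\<eta> > 0\<close> G by (auto simp: N_def)
      then have "N\<^sup>2 / 4 > 0" by simp
      with e have "\<forall>\<^sub>F l in sequentially. e l < N\<^sup>2 / 4" by (rule order_tendstoD)
      then obtain n where n: "\<And>l. l \<ge> n \<Longrightarrow> e l < N\<^sup>2 / 4" by (auto simp: eventually_sequentially)
      have "\<bar>D i \<alpha> \<beta> x t - D j \<alpha> \<beta> x t\<bar> < \<eta>"
        if ij: "i \<ge> n" "j \<ge> n" and xt: "x \<in> {0..1}" "t > 6 / a" for i j x t
      proof -
        have "\<bar>D i \<alpha> \<beta> x t - D j \<alpha> \<beta> x t\<bar> \<le> G * exp (- \<gamma> * t) * N"
          by (rule est_diff) (use N n[OF ij(1)] n[OF ij(2)] xt \<open>\<alpha> + \<beta> \<le> 2\<close> in auto)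
        also have "\<dots> \<le> G * 1 * N"
          using decr[OF xt(2)] G N by (intro mult_right_mono mult_left_mono) auto
        also have "\<dots> < \<eta>" using N by simp
        finally show ?thesis .
      qed
      then show "\<exists>M. \<forall>z\<in>{0..1} \<times> {6/a<..}. \<forall>i\<ge>M. \<forall>j\<ge>M.
          dist (case z of (x, t) \<Rightarrow> D i \<alpha> \<beta> x t) (case z of (x, t) \<Rightarrow> D j \<alpha> \<beta> x t) < \<eta>"
        by (intro exI[of _ n]) (auto simp: dist_real_def)
    qed
    have pos: "6 / a > 0" using assms by simp
    have DL: "C2_family {0..1} {6/a<..} (D l)" for l
      by (rule C2_family_subset[OF wave_system.W[OF sys]])
         (unfold subset_iff greaterThan_iff atLeast_iff, use pos less_trans less_imp_le in blast)
    obtain L where fam: "C2_family {0..1} {6/a<..} L"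
      and lim: "\<And>\<alpha> \<beta>. \<alpha> + \<beta> \<le> 2 \<Longrightarrow> uniform_limit ({0..1} \<times> {6/a<..})
        (\<lambda>l (x, t). D l \<alpha> \<beta> x t) (\<lambda>(x, t). L \<alpha> \<beta> x t) sequentially"
      by (rule C2_family_Cauchy[OF DL _ _ Cauchy]) auto
    have partial_L: "partial {0..1} {6/a<..} \<alpha> \<beta> (L 0 0) x t = L \<alpha> \<beta> x t"
      if "\<alpha> + \<beta> \<le> 2" "x \<in> {0..1}" "t > 6/a" for \<alpha> \<beta> x t
      by (rule partial_eq_C2_family[OF fam]) (use that at_within_nonbot in auto)
    have pt: "(\<lambda>l. D l \<alpha> \<beta> x t) \<longlonglongrightarrow> L \<alpha> \<beta> x t" if "\<alpha> + \<beta> \<le> 2" "x \<in> {0..1}" "t > 6/a" for \<alpha> \<beta> x t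
      using tendsto_uniform_limitI[OF lim[OF that(1)], of "(x, t)"] that by simp
    have L_bound: "\<bar>L \<alpha> \<beta> x t\<bar> \<le> M\<^sub>2 * exp (- \<gamma> * t) * m"
      if "\<alpha> + \<beta> \<le> 2" "x \<in> {0..1}" "t > 6/a" for \<alpha> \<beta> x t
    proof -
      let ?g = "G * exp (- \<gamma> * t)"
      have g: "?g > 0" using G by simp
      (* The energy of the approximating data is at most (\<kappa> m)^2 up to a null sequence, so the bound is
         first shown with every N > \<kappa> m. *)
      have "\<bar>L \<alpha> \<beta> x t\<bar> / ?g \<le> N" if N: "N > \<kappa> * m" for N
      proof -
        have "\<kappa> * m \<ge> 0" using \<kappa> m by simp
        then have "(\<kappa> * m)\<^sup>2 < N\<^sup>2" using N by (intro power_strict_mono) auto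
        then have "(N\<^sup>2 - 2 * E\<^sub>0) / 2 > 0" using E\<^sub>0 by simp
        with e have "\<forall>\<^sub>F l in sequentially. e l < (N\<^sup>2 - 2 * E\<^sub>0) / 2" by (rule order_tendstoD)
        then have "\<forall>\<^sub>F l in sequentially. \<bar>D l \<alpha> \<beta> x t\<bar> \<le> ?g * N"
        proof eventually_elim
          case (elim l)
          show ?case
            by (rule est) (use elim N \<open>\<kappa> * m \<ge> 0\<close> \<open>\<alpha> + \<beta> \<le> 2\<close> \<open>x \<in> {0..1}\<close> \<open>t > 6/a\<close> in auto)
        qed
        moreover have "(\<lambda>l. \<bar>D l \<alpha> \<beta> x t\<bar>) \<longlonglongrightarrow> \<bar>L \<alpha> \<beta> x t\<bar>"
          by (intro tendsto_rabs pt) fact+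
        ultimately have "\<bar>L \<alpha> \<beta> x t\<bar> \<le> ?g * N"
          by (intro tendsto_upperbound) auto
        then show ?thesis using g by (simp add: pos_divide_le_eq mult.commute)
      qed
      then have "\<bar>L \<alpha> \<beta> x t\<bar> / ?g \<le> \<kappa> * m" by (rule dense_ge)
      then have "\<bar>L \<alpha> \<beta> x t\<bar> \<le> (G * \<kappa>) * exp (- \<gamma> * t) * m"
        using g by (simp add: pos_divide_le_eq ac_simps)
      also have "\<dots> \<le> M\<^sub>2 * exp (- \<gamma> * t) * m"
        using m by (intro mult_right_mono) (auto simp: M\<^sub>2_def)
      finally show ?thesis .
    qed
    have ae: "AE x in unit_lebesgue. w x t = L 0 0 x t" if t: "t > 6/a" for t
    proof (rule L2_limit_eq_uniform_limit)
      have t': "t > 0" using t pos by linarith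
      show "L2 (\<lambda>x. w x t)" using cw t' by (simp add: continuous_into_L2_def)
      show "continuous_on {0..1} (\<lambda>x. D l 0 0 x t)" for l
        by (rule continuous_on_slice(2)[OF C2_family_continuous[OF DL]]) (use t in auto)
      show "continuous_on {0..1} (\<lambda>x. L 0 0 x t)"
        by (rule continuous_on_slice(2)[OF C2_family_continuous[OF fam]]) (use t in auto)
      show "(\<lambda>l. L2_norm (\<lambda>x. w x t - D l 0 0 x t)) \<longlonglongrightarrow> 0"
        using tendsto_uniform_limitI[OF wl[OF t'], of t] t' by (simp add: D_def partial_def)
      show "uniform_limit {0..1} (\<lambda>l x. D l 0 0 x t) (\<lambda>x. L 0 0 x t) sequentially"
        using uniform_limit_compose'[OF lim[of 0 0], of "\<lambda>x. (x, t)" "{0..1}"] t by auto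
    qed
    show "\<exists>W. (\<forall>t>6/a. AE x in unit_lebesgue. w x t = W x t) \<and>
             C2_on {0..1} {6/a<..} W \<and>
             (\<forall>\<alpha> \<beta>. \<alpha> + \<beta> \<le> 2 \<longrightarrow>
               (\<forall>t>6/a. sup_norm {0..1} (\<lambda>x. partial {0..1} {6/a<..} \<alpha> \<beta> W x t)
                   \<le> M\<^sub>2 * exp (- \<gamma> * t) * max (H1_norm w\<^sub>0) (L2_norm w\<^sub>1)))"
    proof (intro exI[of _ "L 0 0"] conjI allI impI ae)
      show "C2_on {0..1} {6/a<..} (L 0 0)"
        by (rule C2_on_C2_family[OF fam]) (use at_within_nonbot in auto)
      fix \<alpha> \<beta> :: nat and t :: real assume "\<alpha> + \<beta> \<le> 2" "t > 6/a"
      then show "sup_norm {0..1} (\<lambda>x. partial {0..1} {6/a<..} \<alpha> \<beta> (L 0 0) x t)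
          \<le> M\<^sub>2 * exp (- \<gamma> * t) * max (H1_norm w\<^sub>0) (L2_norm w\<^sub>1)"
        unfolding sup_norm_def m_def[symmetric]
        by (intro cSUP_least) (simp_all only: partial_L L_bound, simp)
    qed
  qed
qed

end
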